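(* Let $k=(k_1,k_2)\in\mathbb{Z}^2$ and let $c=(c_1,c_2),d=(d_1,d_2)\in\mathbb{R}^2$ be such that $8|c_1d_1|<1$ and $8|c_2d_2|<1$. Suppose that $h$ is a faithful positive linear functional on the $\ast$-algebra $\mathfrak{A}(\mathbb{R}^2)$ such that $$h\big(a(x_1+\beta s,x_2+\alpha t)\big)=e^{-2\pi\gamma(s+t)-4\pi(k_1s+k_2t)}h(a),\qquad |h(a)|\le C\,\|S(e^{c\mathcal{Q}})S(e^{d\mathcal{P}})a\|$$ for some positive constant $C$ and for all $s,t\in\mathbb{R}$ and $a\in\mathfrak{A}(\mathbb{R}^2)$. Then there is a positive constant $\nu$ such that $h=\nu h_k$.
   Context: Parameters: $q\neq\pm1$ is a complex number of modulus one, $\gamma\in\mathbb{R}$ is fixed with $q=e^{2\pi i\gamma}$, and $\alpha,\beta\in\mathbb{R}$ satisfy $\alpha\beta=\gamma$. $\mathfrak{A}(\mathbb{R}^2)$ is the space of functions $a(x_1,x_2)$ on $\mathbb{R}^2$ that extend to entire functions on $\mathbb{C}^2$ (same symbol) with $\sup_{|y_1|<\nu_1,|y_2|<\nu_2}\iint|a(x_1+iy_1,x_2+iy_2)|^2e^{4\pi(\mu_1|x_1|+\mu_2|x_2|)}dx_1dx_2<\infty$ for all $\mu_1,\mu_2,\nu_1,\nu_2>0$. It is a $\ast$-algebra with product $$(a\# b)(x_1,x_2)=4\iiiint a(u_1,u_2)b(v_1,v_2)e^{4\pi i[(x_1-u_1)(x_2-v_2)-(x_1-v_1)(x_2-u_2)]}du_1du_2dv_1dv_2$$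 and involution $a^\ast(x_1,x_2)=\overline{a(x_1,x_2)}$ for real $x_1,x_2$. A linear functional $h$ is positive if $h(a^\ast\#a)\ge0$ for all $a$, and faithful if $h(a^\ast\#a)=0$ implies $a=0$. $h_k(a)=\iint e^{2\pi(\alpha_kx_1+\beta_kx_2)}a(x_1,x_2)dx_1dx_2$ with $\alpha_k:=\alpha+2\beta^{-1}k_1$, $\beta_k:=\beta+2\alpha^{-1}k_2$. With $\mathcal{Q}_j$ = multiplication by $x_j$ and $\mathcal{P}_j=\frac{1}{2\pi i}\partial/\partial x_j$ on $L^2(\mathbb{R}^2)$ (norm $\|\cdot\|$), $S(e^{c\mathcal{Q}}):=(e^{c_1\mathcal{Q}_1}+e^{-c_1\mathcal{Q}_1})(e^{c_2\mathcal{Q}_2}+e^{-c_2\mathcal{Q}_2})$ and $S(e^{d\mathcal{P}}):=(e^{d_1\mathcal{P}_1}+e^{-d_1\mathcal{P}_1})(e^{d_2\mathcal{P}_2}+e^{-d_2\mathcal{P}_2})$; on $\mathfrak{A}(\mathbb{R}^2)$, $e^{2\pi s\mathcal{P}_1}$ acts as $a\mapsto a(x_1-is,x_2)$ and $e^{2\pi s\mathcal{P}_2}$ as $a\mapsto a(x_1,x_2-is)$, $s\in\mathbb{R}$. *)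

theory Defs
  imports "HOL-Complex_Analysis.Complex_Analysis"
begin

type_synonym plane_fun = "real \<times> real \<Rightarrow> complex"

text \<open>Holomorphy in two variables: real differentiability with a complex linear derivative.\<close>

definition entire2 :: "(complex \<times> complex \<Rightarrow> complex) \<Rightarrow> bool" where
  "entire2 F \<longleftrightarrow> (\<forall>z. \<exists>A B. (F has_derivative (\<lambda>w. A * fst w + B * snd w)) (at z))"

definition extends :: "(complex \<times> complex \<Rightarrow> complex) \<Rightarrow> plane_fun \<Rightarrow> bool" where
  "extends F a \<longleftrightarrow> (\<forall>x1 x2. F (complex_of_real x1, complex_of_real x2) = a (x1, x2))"

lemma entire2_holomorphic_fst:
  assumes "entire2 F"
  shows "(\<lambda>z. F (z, w)) holomorphic_on UNIV"
proof -
  have "\<exists>A. ((\<lambda>z. F (z, w)) has_field_derivative A) (at z)" for z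
  proof -
    obtain A B where D: "(F has_derivative (\<lambda>u. A * fst u + B * snd u)) (at (z, w))"
      using assms unfolding entire2_def by blast
    have P: "((\<lambda>z. (z, w)) has_derivative (\<lambda>h. (h, 0))) (at z)"
      by (rule has_derivative_Pair) (rule has_derivative_ident has_derivative_const)+
    show ?thesis
      using has_derivative_compose[OF P D]
      unfolding has_field_derivative_def by auto
  qed
  then show ?thesis
    by (auto simp: holomorphic_on_def field_differentiable_def)
qed

lemma entire2_holomorphic_snd:
  assumes "entire2 F"
  shows "(\<lambda>w. F (z, w)) holomorphic_on UNIV"
proof -
  have "\<exists>B. ((\<lambda>w. F (z, w)) has_field_derivative B) (at w)" for w
  proof -
    obtain A B where D: "(F has_derivative (\<lambda>u. A * fst u + B * snd u)) (at (z, w))"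
      using assms unfolding entire2_def by blast
    have P: "((\<lambda>w. (z, w)) has_derivative (\<lambda>h. (0, h))) (at w)"
      by (rule has_derivative_Pair) (rule has_derivative_ident has_derivative_const)+
    show ?thesis
      using has_derivative_compose[OF P D]
      unfolding has_field_derivative_def by auto
  qed
  then show ?thesis
    by (auto simp: holomorphic_on_def field_differentiable_def)
qed

lemma holomorphic_eq_of_eq_on_reals:
  assumes "f holomorphic_on UNIV" "g holomorphic_on UNIV"
    and eq: "\<And>x. f (complex_of_real x) = g (complex_of_real x)"
  shows "f z = g z"
proof -
  have lim: "(0::complex) islimpt (range complex_of_real)"
    unfolding islimpt_approachable
  proof (intro allI impI)
    fix e :: real assume "e > 0"
    then show "\<exists>y\<in>range complex_of_real. y \<noteq> 0 \<and> dist y 0 < e"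
      by (intro bexI[of _ "complex_of_real (e / 2)"] rangeI) auto
  qed
  have "(\<lambda>z. f z - g z) z = 0"
  proof (rule analytic_continuation[of "\<lambda>z. f z - g z" UNIV "range complex_of_real" 0])
    show "(\<lambda>z. f z - g z) holomorphic_on UNIV"
      using assms(1,2) by (rule holomorphic_on_diff)
    show "(0::complex) islimpt (range complex_of_real)" by (rule lim)
    show "f w - g w = 0" if "w \<in> range complex_of_real" for w
      using that eq by auto
  qed auto
  then show ?thesis by simp
qed

lemma entire_extension_unique:
  assumes "entire2 F" "entire2 G" "extends F a" "extends G a"
  shows "F = G"
proof -
  have real_fst: "F (of_real x1, z2) = G (of_real x1, z2)" for x1 z2
  proof (rule holomorphic_eq_of_eq_on_reals[where f = "\<lambda>w. F (of_real x1, w)"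
        and g = "\<lambda>w. G (of_real x1, w)"])
    show "(\<lambda>w. F (of_real x1, w)) holomorphic_on UNIV"
      by (rule entire2_holomorphic_snd[OF assms(1)])
    show "(\<lambda>w. G (of_real x1, w)) holomorphic_on UNIV"
      by (rule entire2_holomorphic_snd[OF assms(2)])
    show "F (of_real x1, of_real x2) = G (of_real x1, of_real x2)" for x2
      using assms(3,4) by (simp add: extends_def)
  qed
  have "F (z1, z2) = G (z1, z2)" for z1 z2
  proof (rule holomorphic_eq_of_eq_on_reals[where f = "\<lambda>z. F (z, z2)" and g = "\<lambda>z. G (z, z2)"])
    show "(\<lambda>z. F (z, z2)) holomorphic_on UNIV"
      by (rule entire2_holomorphic_fst[OF assms(1)])
    show "(\<lambda>z. G (z, z2)) holomorphic_on UNIV"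
      by (rule entire2_holomorphic_fst[OF assms(2)])
    show "F (of_real x1, z2) = G (of_real x1, z2)" for x1
      by (rule real_fst)
  qed
  then show ?thesis by auto
qed

text \<open>Meaningful only for functions that have an entire extension; the extension is then unique
  by the preceding lemma.\<close>

definition entire_ext :: "plane_fun \<Rightarrow> complex \<times> complex \<Rightarrow> complex" where
  "entire_ext a = (THE F. entire2 F \<and> extends F a)"

definition algA :: "plane_fun set" where
  "algA = {a. (\<exists>F. entire2 F \<and> extends F a) \<and>
     (\<forall>\<mu>1>0. \<forall>\<mu>2>0. \<forall>\<nu>1>0. \<forall>\<nu>2>0.
        (SUP (y1, y2) \<in> {y1. \<bar>y1\<bar> < \<nu>1} \<times> {y2. \<bar>y2\<bar> < \<nu>2}.
           \<integral>\<^sup>+ (x1, x2). ennreal ((cmod (entire_ext a (Complex x1 y1, Complex x2 y2)))\<^sup>2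
               * exp (4 * pi * (\<mu>1 * \<bar>x1\<bar> + \<mu>2 * \<bar>x2\<bar>))) \<partial>lborel) < \<infinity>)}"

definition alg_mult :: "plane_fun \<Rightarrow> plane_fun \<Rightarrow> plane_fun" where
  "alg_mult a b = (\<lambda>(x1, x2).
     4 * (LINT ((u1, u2), (v1, v2)) | lborel.
            a (u1, u2) * b (v1, v2) *
            exp (4 * pi * \<i> * of_real ((x1 - u1) * (x2 - v2) - (x1 - v1) * (x2 - u2)))))"

definition alg_star :: "plane_fun \<Rightarrow> plane_fun" where
  "alg_star a = (\<lambda>x. cnj (a x))"

text \<open>Functionals on the algebra are functions on the whole function type of which only the
  values on \<open>algA\<close> matter.\<close>

definition linear_functional :: "(plane_fun \<Rightarrow> complex) \<Rightarrow> bool" where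
  "linear_functional h \<longleftrightarrow>
     (\<forall>a\<in>algA. \<forall>b\<in>algA. h (\<lambda>x. a x + b x) = h a + h b) \<and>
     (\<forall>r. \<forall>a\<in>algA. h (\<lambda>x. r * a x) = r * h a)"

definition positive_functional :: "(plane_fun \<Rightarrow> complex) \<Rightarrow> bool" where
  "positive_functional h \<longleftrightarrow> (\<forall>a\<in>algA. h (alg_mult (alg_star a) a) \<in> \<real>\<^sub>\<ge>\<^sub>0)"

definition faithful_functional :: "(plane_fun \<Rightarrow> complex) \<Rightarrow> bool" where
  "faithful_functional h \<longleftrightarrow>
     (\<forall>a\<in>algA. h (alg_mult (alg_star a) a) = 0 \<longrightarrow> a = (\<lambda>x. 0))"

definition \<alpha>k :: "real \<Rightarrow> real \<Rightarrow> int \<times> int \<Rightarrow> real" where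
  "\<alpha>k \<alpha> \<beta> k = \<alpha> + 2 * inverse \<beta> * of_int (fst k)"

definition \<beta>k :: "real \<Rightarrow> real \<Rightarrow> int \<times> int \<Rightarrow> real" where
  "\<beta>k \<alpha> \<beta> k = \<beta> + 2 * inverse \<alpha> * of_int (snd k)"

definition hk :: "real \<Rightarrow> real \<Rightarrow> int \<times> int \<Rightarrow> plane_fun \<Rightarrow> complex" where
  "hk \<alpha> \<beta> k a = (LINT (x1, x2) | lborel.
     of_real (exp (2 * pi * (\<alpha>k \<alpha> \<beta> k * x1 + \<beta>k \<alpha> \<beta> k * x2))) * a (x1, x2))"

definition exp_Q1 :: "real \<Rightarrow> plane_fun \<Rightarrow> plane_fun" where
  "exp_Q1 c a = (\<lambda>(x1, x2). of_real (exp (c * x1)) * a (x1, x2))"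

definition exp_Q2 :: "real \<Rightarrow> plane_fun \<Rightarrow> plane_fun" where
  "exp_Q2 c a = (\<lambda>(x1, x2). of_real (exp (c * x2)) * a (x1, x2))"

text \<open>Since \<open>P\<^sub>j = (2 \<pi> i)\<^sup>-\<^sup>1 \<partial>/\<partial>x\<^sub>j\<close>, the operator \<open>exp (2 \<pi> s P\<^sub>j)\<close> shifts \<open>x\<^sub>j\<close> to \<open>x\<^sub>j - i s\<close>,
  so \<open>exp (d P\<^sub>j)\<close> is the shift with \<open>s = d / (2 \<pi>)\<close>.\<close>

definition exp_P1 :: "real \<Rightarrow> plane_fun \<Rightarrow> plane_fun" where
  "exp_P1 d a = (\<lambda>(x1, x2).
     entire_ext a (of_real x1 - \<i> * of_real (d / (2 * pi)), of_real x2))"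

definition exp_P2 :: "real \<Rightarrow> plane_fun \<Rightarrow> plane_fun" where
  "exp_P2 d a = (\<lambda>(x1, x2).
     entire_ext a (of_real x1, of_real x2 - \<i> * of_real (d / (2 * pi))))"

definition op_add ::
  "(plane_fun \<Rightarrow> plane_fun) \<Rightarrow> (plane_fun \<Rightarrow> plane_fun) \<Rightarrow> plane_fun \<Rightarrow> plane_fun" where
  "op_add S T a = (\<lambda>x. S a x + T a x)"

definition S_expQ :: "real \<times> real \<Rightarrow> plane_fun \<Rightarrow> plane_fun" where
  "S_expQ c = op_add (exp_Q1 (fst c)) (exp_Q1 (- fst c))
            \<circ> op_add (exp_Q2 (snd c)) (exp_Q2 (- snd c))"

definition S_expP :: "real \<times> real \<Rightarrow> plane_fun \<Rightarrow> plane_fun" where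
  "S_expP d = op_add (exp_P1 (fst d)) (exp_P1 (- fst d))
            \<circ> op_add (exp_P2 (snd d)) (exp_P2 (- snd d))"

text \<open>The Bochner integral of a non-integrable function is 0, so this is the norm only for square
  integrable arguments, such as \<open>S_expQ c (S_expP d a)\<close> with \<open>a \<in> algA\<close>.\<close>

definition norm_L2 :: "plane_fun \<Rightarrow> real" where
  "norm_L2 f = sqrt (LINT x | lborel. (cmod (f x))\<^sup>2)"

end

theory Submission
  imports Defs "HOL-Probability.Probability"
begin

text \<open>The covariance of \<open>h\<close> says that \<open>h\<close> transforms under every real translation like \<open>h\<^sub>k\<close>.
  Integrating it against \<open>\<phi>\<close> gives, for all \<open>a\<close> and \<open>\<phi>\<close> in the algebra, \<open>h (\<phi> * a) = h\<^sub>k \<phi> \<cdot> h a\<close>, and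
  exchanging the roles of \<open>a\<close> and \<open>\<phi>\<close> yields \<open>h\<^sub>k \<phi> \<cdot> h a = h\<^sub>k a \<cdot> h \<phi>\<close>. To move \<open>h\<close> through the
  integral, \<open>h\<close> is approximated by inner products \<open>a \<mapsto> \<langle>T v, T a\<rangle>\<close> with \<open>T = S(e\<^sup>c\<^sup>Q) S(e\<^sup>d\<^sup>P)\<close>, for which
  Fubini applies; the convolution itself never has to be placed in the algebra. Since \<open>T\<close> contains
  imaginary shifts, the symmetry in \<open>a\<close> and \<open>\<phi>\<close> comes from shifting the contour of
  \<open>\<integral> \<phi>(x + iy - u) a(u) du\<close>. Finally \<open>\<phi>\<close> is the Gaussian \<open>exp (- 2 \<pi> \<bar>x\<bar>\<^sup>2)\<close>, whose double is a
  projection for the product \<open>#\<close>, so that positivity and faithfulness give \<open>h \<phi> > 0\<close>.\<close>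

section \<open>Lebesgue measure on Euclidean spaces\<close>

text \<open>The only continuity available for \<open>h\<close> is with respect to the norm of T,
  which in general is not translation invariant. What saves the smearing over translations is that
  S(e^{cQ}) is multiplication by a product of hyperbolic cosines: this weight is submultiplicative,
  so translating by u enlarges the norm by at most the factor \<open>weight c u\<close>, and that
  factor is integrable against every element of the algebra. An approximation of \<open>h\<close>
  with error \<epsilon> times the norm therefore stays good after integration over all u, with a
  constant that does not depend on the approximating vector. Approximate representation also avoids
  completing the range of T: the representing vector is an honest square integrable function T v.
  S(e^{dP}) commutes with real translations, so it acts on only one factor of the convolution;
  exchanging the factors means moving it from one to the other, which is where holomorphy enters.
  For the normalisation one element with \<open>h\<close> nonzero suffices. Positivity and
  faithfulness speak only about elements of the form \<open>alg_mult (alg_star a) a\<close>, so one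
  wants an element that is itself a multiple of such a product.\<close>

lemma measurable_fst_snd_borel [measurable]:
  "fst \<in> borel_measurable (borel :: ('a::topological_space \<times> 'b::topological_space) measure)"
  "snd \<in> borel_measurable (borel :: ('a::topological_space \<times> 'b::topological_space) measure)"
  by (intro borel_measurable_continuous_onI continuous_intros)+

lemma measurable_cnj_borel [measurable]: "cnj \<in> borel_measurable borel"
  by (intro borel_measurable_continuous_onI continuous_intros)

lemma distr_reflect:
  fixes c :: "'a::euclidean_space"
  shows "distr lborel borel (\<lambda>x. c - x) = lborel"
  by (subst lborel_affine[of "-1" c]) (auto simp: density_1)

lemma integral_reflect:
  fixes f :: "'b::euclidean_space \<Rightarrow> 'a::{banach, second_countable_topology}"
  assumes [measurable]: "f \<in> borel_measurable borel"
  shows "(LINT x|lborel. f (c - x)) = (LINT x|lborel. f x)"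
  by (subst (2) distr_reflect[of c, symmetric]) (simp add: integral_distr)

lemma nn_integral_reflect:
  fixes f :: "'b::euclidean_space \<Rightarrow> ennreal"
  assumes [measurable]: "f \<in> borel_measurable borel"
  shows "(\<integral>\<^sup>+x. f (c - x) \<partial>lborel) = (\<integral>\<^sup>+x. f x \<partial>lborel)"
  by (subst (2) distr_reflect[of c, symmetric]) (simp add: nn_integral_distr)

lemma nn_integral_translate:
  fixes f :: "'b::euclidean_space \<Rightarrow> ennreal"
  assumes [measurable]: "f \<in> borel_measurable borel"
  shows "(\<integral>\<^sup>+x. f (x - c) \<partial>lborel) = (\<integral>\<^sup>+x. f x \<partial>lborel)"
proof -
  have "(\<integral>\<^sup>+x. f (x - c) \<partial>lborel) = (\<integral>\<^sup>+x. f (- c + x) \<partial>lborel)" by simp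
  also have "\<dots> = (\<integral>\<^sup>+x. f x \<partial>lborel)"
    by (subst (2) lborel_distr_plus[of "- c", symmetric]) (simp add: nn_integral_distr)
  finally show ?thesis .
qed

lemma integral_translate:
  fixes f :: "'b::euclidean_space \<Rightarrow> 'a::{banach, second_countable_topology}"
  assumes [measurable]: "f \<in> borel_measurable borel"
  shows "(LINT x|lborel. f (x - c)) = (LINT x|lborel. f x)"
proof -
  have "(LINT x|lborel. f (x - c)) = (LINT x|lborel. f (- c + x))" by simp
  also have "\<dots> = (LINT x|lborel. f x)"
    by (subst (2) lborel_distr_plus[of "- c", symmetric]) (simp add: integral_distr)
  finally show ?thesis .
qed

lemma integrable_translate:
  fixes f :: "'b::euclidean_space \<Rightarrow> 'a::{banach, second_countable_topology}"
  assumes "integrable lborel f"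
  shows "integrable lborel (\<lambda>x. f (x - c))"
proof -
  have [measurable]: "f \<in> borel_measurable borel" using borel_measurable_integrable[OF assms] by simp
  have "(\<integral>\<^sup>+x. ennreal (norm (f (x - c))) \<partial>lborel) = (\<integral>\<^sup>+x. ennreal (norm (f x)) \<partial>lborel)"
    by (rule nn_integral_translate) measurable
  then show ?thesis
    using assms by (auto simp: integrable_iff_bounded)
qed

lemma distr_plane_swap: "distr lborel borel (\<lambda>x. (snd x, fst x)) = (lborel :: (real \<times> real) measure)"
proof -
  have "distr lborel borel (\<lambda>x. (snd x, fst x)) = distr (lborel :: (real \<times> real) measure) lborel (\<lambda>x. (snd x, fst x))"
    by (rule distr_cong[OF refl sets_lborel[symmetric] refl])
  moreover have "lborel = distr lborel (lborel :: (real \<times> real) measure) (\<lambda>(x, y). (y, x))"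
    using lborel_pair.distr_pair_swap[where 'a=real and 'b=real]
    unfolding lborel_prod .
  ultimately show ?thesis
    unfolding split_def by metis
qed

lemma measurable_plane_swap: "(\<lambda>x. (snd x, fst x)) \<in> (borel :: (real \<times> real) measure) \<rightarrow>\<^sub>M borel"
  by (intro borel_measurable_continuous_onI continuous_intros)

lemma nn_integral_plane_swap:
  fixes f :: "real \<times> real \<Rightarrow> ennreal"
  assumes [measurable]: "f \<in> borel_measurable borel"
  shows "(\<integral>\<^sup>+x. f (snd x, fst x) \<partial>lborel) = (\<integral>\<^sup>+x. f x \<partial>lborel)"
  using measurable_plane_swap
  by (subst (2) distr_plane_swap[symmetric]) (simp add: nn_integral_distr)

lemma integral_plane_swap:
  fixes f :: "real \<times> real \<Rightarrow> 'a::{banach, second_countable_topology}"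
  assumes [measurable]: "f \<in> borel_measurable borel"
  shows "(LINT x|lborel. f (snd x, fst x)) = (LINT x|lborel. f x)"
  using measurable_plane_swap
  by (subst (2) distr_plane_swap[symmetric]) (simp add: integral_distr)

text \<open>Stands in for the Cauchy-Schwarz inequality below: a product of two L2 functions is
  dominated by the sum of their squares.\<close>

lemma mult_le_sum_squares:
  fixes p q :: real
  assumes "0 \<le> p" "0 \<le> q"
  shows "p * q \<le> p\<^sup>2 + q\<^sup>2"
  using sum_squares_bound[of p q] mult_nonneg_nonneg[OF assms] by linarith

lemma integrable_lborel_product:
  fixes f :: "'b::euclidean_space \<Rightarrow> 'a::{banach, second_countable_topology, real_normed_algebra}"
    and g :: "'c::euclidean_space \<Rightarrow> 'a"
  assumes f: "integrable lborel f" and g: "integrable lborel g"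
  shows "integrable lborel (\<lambda>x. f (fst x) * g (snd x))"
proof -
  have [measurable]: "f \<in> borel_measurable borel" "g \<in> borel_measurable borel"
    using borel_measurable_integrable[OF f] borel_measurable_integrable[OF g] by simp_all
  have bd: "(\<integral>\<^sup>+x. ennreal (norm (f x)) \<partial>lborel) < \<infinity>" "(\<integral>\<^sup>+x. ennreal (norm (g x)) \<partial>lborel) < \<infinity>"
    using f g by (simp_all add: integrable_iff_bounded)
  have "(\<integral>\<^sup>+x. ennreal (norm (f (fst x) * g (snd x))) \<partial>lborel)
      \<le> (\<integral>\<^sup>+x. ennreal (norm (f (fst x))) * ennreal (norm (g (snd x))) \<partial>lborel)"
    by (intro nn_integral_mono) (simp add: norm_mult_ineq flip: ennreal_mult)
  also have "\<dots> = (\<integral>\<^sup>+x. (\<integral>\<^sup>+y. ennreal (norm (f x)) * ennreal (norm (g y)) \<partial>lborel) \<partial>lborel)"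
    by (subst lborel_prod[symmetric], subst lborel.nn_integral_fst[symmetric]) simp_all
  also have "\<dots> = (\<integral>\<^sup>+x. ennreal (norm (f x)) \<partial>lborel) * (\<integral>\<^sup>+y. ennreal (norm (g y)) \<partial>lborel)"
    by (simp add: nn_integral_cmult nn_integral_multc)
  also have "\<dots> < \<infinity>"
    using bd by (simp add: ennreal_mult_less_top)
  finally show ?thesis
    by (intro integrableI_bounded) simp_all
qed

lemma integrable_convolution_kernel:
  fixes f g :: "'b::euclidean_space \<Rightarrow> 'a::{banach, second_countable_topology, real_normed_algebra}"
  assumes f: "integrable lborel f" and g: "integrable lborel g"
  shows "integrable lborel (\<lambda>(u, x). f u * g (x - u))"
proof -
  have [measurable]: "f \<in> borel_measurable borel" "g \<in> borel_measurable borel"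
    using borel_measurable_integrable[OF f] borel_measurable_integrable[OF g] by simp_all
  have bd: "(\<integral>\<^sup>+x. ennreal (norm (f x)) \<partial>lborel) < \<infinity>" "(\<integral>\<^sup>+x. ennreal (norm (g x)) \<partial>lborel) < \<infinity>"
    using f g by (simp_all add: integrable_iff_bounded)
  have "(\<integral>\<^sup>+p. ennreal (norm (case p of (u, x) \<Rightarrow> f u * g (x - u))) \<partial>lborel)
      \<le> (\<integral>\<^sup>+p. ennreal (norm (f (fst p))) * ennreal (norm (g (snd p - fst p))) \<partial>lborel)"
    by (intro nn_integral_mono) (simp add: split_def norm_mult_ineq flip: ennreal_mult)
  also have "\<dots> = (\<integral>\<^sup>+u. (\<integral>\<^sup>+x. ennreal (norm (f u)) * ennreal (norm (g (x - u))) \<partial>lborel) \<partial>lborel)"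
    by (subst lborel_prod[symmetric], subst lborel.nn_integral_fst[symmetric]) simp_all
  also have "\<dots> = (\<integral>\<^sup>+u. ennreal (norm (f u)) * (\<integral>\<^sup>+x. ennreal (norm (g x)) \<partial>lborel) \<partial>lborel)"
    by (intro nn_integral_cong) (simp add: nn_integral_cmult nn_integral_translate[of "\<lambda>x. ennreal (norm (g x))"])
  also have "\<dots> = (\<integral>\<^sup>+x. ennreal (norm (f x)) \<partial>lborel) * (\<integral>\<^sup>+y. ennreal (norm (g y)) \<partial>lborel)"
    by (simp add: nn_integral_multc)
  also have "\<dots> < \<infinity>"
    using bd by (simp add: ennreal_mult_less_top)
  finally show ?thesis
    by (intro integrableI_bounded) (simp_all add: split_def)
qed

lemma integral_lborel_product:
  fixes f :: "'b::euclidean_space \<Rightarrow> complex" and g :: "'c::euclidean_space \<Rightarrow> complex"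
  assumes f: "integrable lborel f" and g: "integrable lborel g"
  shows "(LINT x|lborel. f (fst x) * g (snd x)) = (LINT x|lborel. f x) * (LINT x|lborel. g x)"
proof -
  have "integrable (lborel \<Otimes>\<^sub>M lborel) (\<lambda>(x, y). f x * g y)"
    using integrable_lborel_product[OF f g] by (simp add: lborel_prod split_def)
  from lborel_pair.integral_fst[OF this]
  have "(LINT x|lborel. LINT y|lborel. f x * g y) = (LINT x|lborel. f (fst x) * g (snd x))"
    by (simp add: lborel_prod split_def)
  then show ?thesis by simp
qed

section \<open>Entire functions with rapid decay on strips\<close>

text \<open>The slice of \<open>F\<close> over the real plane displaced by the imaginary vector
  \<open>y\<close>. The algebra element is \<open>strip F 0\<close>, and an imaginary shift of
  \<open>F\<close> only changes \<open>y\<close>.\<close>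

definition strip :: "(complex \<times> complex \<Rightarrow> complex) \<Rightarrow> real \<times> real \<Rightarrow> plane_fun" where
  "strip F y = (\<lambda>x. F (Complex (fst x) (fst y), Complex (snd x) (snd y)))"

definition norm1 :: "real \<times> real \<Rightarrow> real" where
  "norm1 x = \<bar>fst x\<bar> + \<bar>snd x\<bar>"

text \<open>The decay condition of \<open>algA\<close> stated for the extension itself, which
  removes the definite description. One exponent \<open>m\<close> replaces two, and bounds uniform
  over balls of \<open>norm1\<close> replace suprema over open rectangles; this makes stability
  under sums and complex shifts direct. The value \<open>m = 0\<close> is included, so plain L2
  bounds need no detour.\<close>

definition tame :: "(complex \<times> complex \<Rightarrow> complex) \<Rightarrow> bool" where
  "tame F \<longleftrightarrow> entire2 F \<and> (\<forall>m\<ge>0. \<forall>r. \<exists>M::real. \<forall>y. norm1 y \<le> r \<longrightarrow>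
     (\<integral>\<^sup>+x. ennreal ((cmod (strip F y x))\<^sup>2 * exp (m * norm1 x)) \<partial>lborel) \<le> ennreal M)"

lemma norm1_nonneg [simp]: "0 \<le> norm1 x"
  by (simp add: norm1_def)

lemma norm1_add: "norm1 (x + y) \<le> norm1 x + norm1 y"
  by (simp add: norm1_def)

lemma norm1_minus [simp]: "norm1 (- x) = norm1 x"
  by (simp add: norm1_def)

lemma norm1_diff: "norm1 (x - y) \<le> norm1 x + norm1 y"
  using norm1_add[of x "- y"] by simp

lemma continuous_on_norm1 [continuous_intros]:
  "continuous_on S f \<Longrightarrow> continuous_on S (\<lambda>x. norm1 (f x))"
  unfolding norm1_def by (intro continuous_intros)

lemma measurable_norm1 [measurable]: "norm1 \<in> borel_measurable borel"
  by (intro borel_measurable_continuous_onI continuous_intros)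

lemma entire2_isCont: "entire2 F \<Longrightarrow> isCont F z"
  unfolding entire2_def using has_derivative_continuous by blast

lemma entire2_continuous_on: "entire2 F \<Longrightarrow> continuous_on S F"
  by (simp add: continuous_at_imp_continuous_on entire2_isCont)

lemma entire2_const: "entire2 (\<lambda>z. c)"
  unfolding entire2_def by (auto intro!: exI[of _ 0])

lemma entire2_add: "entire2 F \<Longrightarrow> entire2 G \<Longrightarrow> entire2 (\<lambda>z. F z + G z)"
  unfolding entire2_def
proof
  fix z
  assume F: "\<forall>z. \<exists>A B. (F has_derivative (\<lambda>w. A * fst w + B * snd w)) (at z)"
    and G: "\<forall>z. \<exists>A B. (G has_derivative (\<lambda>w. A * fst w + B * snd w)) (at z)"
  obtain A B where 1: "(F has_derivative (\<lambda>w. A * fst w + B * snd w)) (at z)" using F by blast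
  obtain A' B' where 2: "(G has_derivative (\<lambda>w. A' * fst w + B' * snd w)) (at z)" using G by blast
  show "\<exists>A B. ((\<lambda>z. F z + G z) has_derivative (\<lambda>w. A * fst w + B * snd w)) (at z)"
    using has_derivative_add[OF 1 2]
    by (intro exI[of _ "A + A'"] exI[of _ "B + B'"]) (simp add: algebra_simps)
qed

lemma entire2_mult: "entire2 F \<Longrightarrow> entire2 G \<Longrightarrow> entire2 (\<lambda>z. F z * G z)"
  unfolding entire2_def
proof
  fix z
  assume F: "\<forall>z. \<exists>A B. (F has_derivative (\<lambda>w. A * fst w + B * snd w)) (at z)"
    and G: "\<forall>z. \<exists>A B. (G has_derivative (\<lambda>w. A * fst w + B * snd w)) (at z)"
  obtain A B where 1: "(F has_derivative (\<lambda>w. A * fst w + B * snd w)) (at z)" using F by blast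
  obtain A' B' where 2: "(G has_derivative (\<lambda>w. A' * fst w + B' * snd w)) (at z)" using G by blast
  show "\<exists>A B. ((\<lambda>z. F z * G z) has_derivative (\<lambda>w. A * fst w + B * snd w)) (at z)"
    using has_derivative_mult[OF 1 2]
    by (intro exI[of _ "F z * A' + A * G z"] exI[of _ "F z * B' + B * G z"]) (simp add: algebra_simps)
qed

lemma entire2_affine:
  assumes "entire2 F"
  shows "entire2 (\<lambda>z. F (p * fst z + a, q * snd z + b))"
  unfolding entire2_def
proof
  fix z :: "complex \<times> complex"
  obtain A B where 1: "(F has_derivative (\<lambda>w. A * fst w + B * snd w)) (at (p * fst z + a, q * snd z + b))"
    using assms unfolding entire2_def by blast
  have 2: "((\<lambda>z. (p * fst z + a, q * snd z + b)) has_derivative (\<lambda>h. (p * fst h, q * snd h))) (at z)"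
    by (auto intro!: derivative_eq_intros)
  show "\<exists>A B. ((\<lambda>z. F (p * fst z + a, q * snd z + b)) has_derivative (\<lambda>w. A * fst w + B * snd w)) (at z)"
    using has_derivative_compose[OF 2 1]
    by (intro exI[of _ "A * p"] exI[of _ "B * q"]) (simp add: algebra_simps)
qed

lemma entire2_swap:
  assumes "entire2 F"
  shows "entire2 (\<lambda>z. F (snd z, fst z))"
  unfolding entire2_def
proof
  fix z :: "complex \<times> complex"
  obtain A B where 1: "(F has_derivative (\<lambda>w. A * fst w + B * snd w)) (at (snd z, fst z))"
    using assms unfolding entire2_def by blast
  have 2: "((\<lambda>z. (snd z, fst z)) has_derivative (\<lambda>h. (snd h, fst h))) (at z)"
    by (auto intro!: derivative_eq_intros)
  show "\<exists>A B. ((\<lambda>z. F (snd z, fst z)) has_derivative (\<lambda>w. A * fst w + B * snd w)) (at z)"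
    using has_derivative_compose[OF 2 1]
    by (intro exI[of _ B] exI[of _ A]) (simp add: algebra_simps)
qed

lemma continuous_on_strip:
  assumes "entire2 F"
  shows "continuous_on S (strip F y)"
  unfolding strip_def Complex_eq
  by (intro continuous_intros continuous_on_compose2[OF entire2_continuous_on[OF assms, of UNIV]]) auto

lemma measurable_strip [measurable (raw)]:
  "entire2 F \<Longrightarrow> strip F y \<in> borel_measurable borel"
  by (intro borel_measurable_continuous_onI continuous_on_strip)

lemma tameI:
  assumes "entire2 F"
    and "\<And>m r. 0 \<le> m \<Longrightarrow> 0 \<le> r \<Longrightarrow> \<exists>M::real. \<forall>y. norm1 y \<le> r \<longrightarrow>
     (\<integral>\<^sup>+x. ennreal ((cmod (strip F y x))\<^sup>2 * exp (m * norm1 x)) \<partial>lborel) \<le> ennreal M"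
  shows "tame F"
  unfolding tame_def
proof (intro conjI allI impI)
  fix m r :: real assume "0 \<le> m"
  show "\<exists>M::real. \<forall>y. norm1 y \<le> r \<longrightarrow>
     (\<integral>\<^sup>+x. ennreal ((cmod (strip F y x))\<^sup>2 * exp (m * norm1 x)) \<partial>lborel) \<le> ennreal M"
  proof (cases "0 \<le> r")
    case True with assms(2) \<open>0 \<le> m\<close> show ?thesis by blast
  next
    case False
    then have "\<not> norm1 y \<le> r" for y using norm1_nonneg[of y] by linarith
    then show ?thesis by blast
  qed
qed fact

lemma tame_entire2: "tame F \<Longrightarrow> entire2 F"
  by (simp add: tame_def)

text \<open>Here \<open>m\<close> may have either sign, since a negative exponent is dominated by
  its absolute value; \<open>M\<close> is made nonnegative for later \<open>ennreal\<close>
  arithmetic.\<close>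

lemma tameE:
  assumes "tame F"
  obtains M where "0 \<le> M" and "\<And>y. norm1 y \<le> r \<Longrightarrow>
     (\<integral>\<^sup>+x. ennreal ((cmod (strip F y x))\<^sup>2 * exp (m * norm1 x)) \<partial>lborel) \<le> ennreal M"
proof -
  obtain M where M: "\<forall>y. norm1 y \<le> r \<longrightarrow>
     (\<integral>\<^sup>+x. ennreal ((cmod (strip F y x))\<^sup>2 * exp (\<bar>m\<bar> * norm1 x)) \<partial>lborel) \<le> ennreal M"
    using assms unfolding tame_def by (meson abs_ge_zero)
  show ?thesis
  proof (rule that[of "max M 0"])
    fix y assume y: "norm1 y \<le> r"
    have "(\<integral>\<^sup>+x. ennreal ((cmod (strip F y x))\<^sup>2 * exp (m * norm1 x)) \<partial>lborel)
        \<le> (\<integral>\<^sup>+x. ennreal ((cmod (strip F y x))\<^sup>2 * exp (\<bar>m\<bar> * norm1 x)) \<partial>lborel)"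
      by (intro nn_integral_mono ennreal_leI mult_left_mono) (auto intro: mult_right_mono)
    also have "\<dots> \<le> ennreal M" using M y by blast
    also have "\<dots> \<le> ennreal (max M 0)" by (intro ennreal_leI) auto
    finally show "(\<integral>\<^sup>+x. ennreal ((cmod (strip F y x))\<^sup>2 * exp (m * norm1 x)) \<partial>lborel) \<le> ennreal (max M 0)" .
  qed auto
qed

lemma tame_add:
  assumes F: "tame F" and G: "tame G"
  shows "tame (\<lambda>z. F z + G z)"
proof (rule tameI)
  note [measurable] = measurable_strip[OF tame_entire2[OF F]] measurable_strip[OF tame_entire2[OF G]]
  show "entire2 (\<lambda>z. F z + G z)" by (intro entire2_add tame_entire2 F G)
  fix m r :: real
  obtain M where "0 \<le> M" and M: "\<And>y. norm1 y \<le> r \<Longrightarrow>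
     (\<integral>\<^sup>+x. ennreal ((cmod (strip F y x))\<^sup>2 * exp (m * norm1 x)) \<partial>lborel) \<le> ennreal M"
    using tameE[OF F, where r = r and m = m] by blast
  obtain N where "0 \<le> N" and N: "\<And>y. norm1 y \<le> r \<Longrightarrow>
     (\<integral>\<^sup>+x. ennreal ((cmod (strip G y x))\<^sup>2 * exp (m * norm1 x)) \<partial>lborel) \<le> ennreal N"
    using tameE[OF G, where r = r and m = m] by blast
  show "\<exists>M. \<forall>y. norm1 y \<le> r \<longrightarrow>
     (\<integral>\<^sup>+x. ennreal ((cmod (strip (\<lambda>z. F z + G z) y x))\<^sup>2 * exp (m * norm1 x)) \<partial>lborel) \<le> ennreal M"
  proof (intro exI[of _ "2 * M + 2 * N"] allI impI)
    fix y assume y: "norm1 y \<le> r"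
    have "(\<integral>\<^sup>+x. ennreal ((cmod (strip (\<lambda>z. F z + G z) y x))\<^sup>2 * exp (m * norm1 x)) \<partial>lborel)
      \<le> (\<integral>\<^sup>+x. 2 * ennreal ((cmod (strip F y x))\<^sup>2 * exp (m * norm1 x)) +
             2 * ennreal ((cmod (strip G y x))\<^sup>2 * exp (m * norm1 x)) \<partial>lborel)"
    proof (rule nn_integral_mono)
      fix x
      have "(cmod (strip (\<lambda>z. F z + G z) y x))\<^sup>2 \<le> (cmod (strip F y x) + cmod (strip G y x))\<^sup>2"
        by (intro power_mono) (auto simp: strip_def norm_triangle_ineq)
      also have "\<dots> \<le> 2 * (cmod (strip F y x))\<^sup>2 + 2 * (cmod (strip G y x))\<^sup>2"
        using sum_squares_bound[of "cmod (strip F y x)" "cmod (strip G y x)"]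
        by (simp add: power2_sum)
      finally have "(cmod (strip (\<lambda>z. F z + G z) y x))\<^sup>2 * exp (m * norm1 x)
          \<le> (2 * (cmod (strip F y x))\<^sup>2 + 2 * (cmod (strip G y x))\<^sup>2) * exp (m * norm1 x)"
        by (rule mult_right_mono) simp
      then have "ennreal ((cmod (strip (\<lambda>z. F z + G z) y x))\<^sup>2 * exp (m * norm1 x))
          \<le> ennreal (2 * ((cmod (strip F y x))\<^sup>2 * exp (m * norm1 x)) + 2 * ((cmod (strip G y x))\<^sup>2 * exp (m * norm1 x)))"
        by (intro ennreal_leI) (simp add: algebra_simps)
      then show "ennreal ((cmod (strip (\<lambda>z. F z + G z) y x))\<^sup>2 * exp (m * norm1 x))
         \<le> 2 * ennreal ((cmod (strip F y x))\<^sup>2 * exp (m * norm1 x)) +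
             2 * ennreal ((cmod (strip G y x))\<^sup>2 * exp (m * norm1 x))"
        by (simp add: ennreal_mult)
    qed
    also have "\<dots> = 2 * (\<integral>\<^sup>+x. ennreal ((cmod (strip F y x))\<^sup>2 * exp (m * norm1 x)) \<partial>lborel) +
             2 * (\<integral>\<^sup>+x. ennreal ((cmod (strip G y x))\<^sup>2 * exp (m * norm1 x)) \<partial>lborel)"
      by (simp add: nn_integral_add nn_integral_cmult)
    also have "\<dots> \<le> 2 * ennreal M + 2 * ennreal N"
      by (intro add_mono mult_left_mono M N y) auto
    also have "\<dots> = ennreal (2 * M + 2 * N)"
      using \<open>0 \<le> M\<close> \<open>0 \<le> N\<close> by (simp add: ennreal_mult)
    finally show "(\<integral>\<^sup>+x. ennreal ((cmod (strip (\<lambda>z. F z + G z) y x))\<^sup>2 * exp (m * norm1 x)) \<partial>lborel)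
       \<le> ennreal (2 * M + 2 * N)" .
  qed
qed

lemma tame_cmult:
  assumes F: "tame F"
  shows "tame (\<lambda>z. c * F z)"
proof (rule tameI)
  note [measurable] = measurable_strip[OF tame_entire2[OF F]]
  show "entire2 (\<lambda>z. c * F z)" by (intro entire2_mult entire2_const tame_entire2 F)
  fix m r :: real
  obtain M where "0 \<le> M" and M: "\<And>y. norm1 y \<le> r \<Longrightarrow>
     (\<integral>\<^sup>+x. ennreal ((cmod (strip F y x))\<^sup>2 * exp (m * norm1 x)) \<partial>lborel) \<le> ennreal M"
    using tameE[OF F, where r = r and m = m] by blast
  show "\<exists>M. \<forall>y. norm1 y \<le> r \<longrightarrow>
     (\<integral>\<^sup>+x. ennreal ((cmod (strip (\<lambda>z. c * F z) y x))\<^sup>2 * exp (m * norm1 x)) \<partial>lborel) \<le> ennreal M"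
  proof (intro exI[of _ "(cmod c)\<^sup>2 * M"] allI impI)
    fix y assume y: "norm1 y \<le> r"
    have "(\<integral>\<^sup>+x. ennreal ((cmod (strip (\<lambda>z. c * F z) y x))\<^sup>2 * exp (m * norm1 x)) \<partial>lborel)
      = (\<integral>\<^sup>+x. ennreal ((cmod c)\<^sup>2) * ennreal ((cmod (strip F y x))\<^sup>2 * exp (m * norm1 x)) \<partial>lborel)"
      by (intro nn_integral_cong)
         (simp add: strip_def norm_mult power_mult_distrib mult.assoc flip: ennreal_mult)
    also have "\<dots> = ennreal ((cmod c)\<^sup>2) * (\<integral>\<^sup>+x. ennreal ((cmod (strip F y x))\<^sup>2 * exp (m * norm1 x)) \<partial>lborel)"
      by (simp add: nn_integral_cmult)
    also have "\<dots> \<le> ennreal ((cmod c)\<^sup>2) * ennreal M"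
      by (intro mult_left_mono M y) auto
    also have "\<dots> = ennreal ((cmod c)\<^sup>2 * M)"
      using \<open>0 \<le> M\<close> by (simp add: ennreal_mult)
    finally show "(\<integral>\<^sup>+x. ennreal ((cmod (strip (\<lambda>z. c * F z) y x))\<^sup>2 * exp (m * norm1 x)) \<partial>lborel)
       \<le> ennreal ((cmod c)\<^sup>2 * M)" .
  qed
qed

text \<open>The real part \<open>s\<close> of the shift costs a factor
  \<open>exp (m * norm1 s)\<close>, by the triangle inequality in the exponent. The imaginary part
  \<open>t\<close> displaces the slice, so the bound for radius \<open>r\<close> comes from the one
  for \<open>r + norm1 t\<close>.\<close>

lemma tame_shift:
  assumes F: "tame F"
  shows "tame (\<lambda>z. F (fst z - a, snd z - b))"
proof (rule tameI)
  note [measurable] = measurable_strip[OF tame_entire2[OF F]]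
  show "entire2 (\<lambda>z. F (fst z - a, snd z - b))"
    using entire2_affine[OF tame_entire2[OF F], of 1 "- a" 1 "- b"] by simp
  fix m r :: real assume m: "0 \<le> m"
  define s t where "s = (Re a, Re b)" and "t = (Im a, Im b)"
  have strip: "strip (\<lambda>z. F (fst z - a, snd z - b)) y x = strip F (y - t) (x - s)" for x y
  proof -
    have "Complex p q - w = Complex (p - Re w) (q - Im w)" for p q w
      by (simp add: complex_eq_iff)
    then show ?thesis by (simp add: strip_def s_def t_def)
  qed
  obtain M where "0 \<le> M" and M: "\<And>y. norm1 y \<le> r + norm1 t \<Longrightarrow>
     (\<integral>\<^sup>+x. ennreal ((cmod (strip F y x))\<^sup>2 * exp (m * norm1 x)) \<partial>lborel) \<le> ennreal M"
    using tameE[OF F, where r = "r + norm1 t" and m = m] by blast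
  show "\<exists>M. \<forall>y. norm1 y \<le> r \<longrightarrow>
     (\<integral>\<^sup>+x. ennreal ((cmod (strip (\<lambda>z. F (fst z - a, snd z - b)) y x))\<^sup>2 * exp (m * norm1 x)) \<partial>lborel) \<le> ennreal M"
  proof (intro exI[of _ "exp (m * norm1 s) * M"] allI impI)
    fix y assume y: "norm1 y \<le> r"
    have "(\<integral>\<^sup>+x. ennreal ((cmod (strip (\<lambda>z. F (fst z - a, snd z - b)) y x))\<^sup>2 * exp (m * norm1 x)) \<partial>lborel)
      \<le> (\<integral>\<^sup>+x. ennreal (exp (m * norm1 s)) *
          ennreal ((cmod (strip F (y - t) (x - s)))\<^sup>2 * exp (m * norm1 (x - s))) \<partial>lborel)"
    proof (rule nn_integral_mono)
      fix x
      have "norm1 x \<le> norm1 s + norm1 (x - s)"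
        using norm1_add[of s "- s + x"] by simp
      then have "exp (m * norm1 x) \<le> exp (m * norm1 s) * exp (m * norm1 (x - s))"
        using m by (simp flip: exp_add add: mult_left_mono flip: distrib_left)
      then have "(cmod (strip F (y - t) (x - s)))\<^sup>2 * exp (m * norm1 x)
         \<le> (cmod (strip F (y - t) (x - s)))\<^sup>2 * (exp (m * norm1 s) * exp (m * norm1 (x - s)))"
        by (rule mult_left_mono) simp
      then show "ennreal ((cmod (strip (\<lambda>z. F (fst z - a, snd z - b)) y x))\<^sup>2 * exp (m * norm1 x))
        \<le> ennreal (exp (m * norm1 s)) *
          ennreal ((cmod (strip F (y - t) (x - s)))\<^sup>2 * exp (m * norm1 (x - s)))"
        unfolding strip by (subst ennreal_mult[symmetric]) (auto intro!: ennreal_leI simp: algebra_simps)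
    qed
    also have "\<dots> = ennreal (exp (m * norm1 s)) *
        (\<integral>\<^sup>+x. ennreal ((cmod (strip F (y - t) (x - s)))\<^sup>2 * exp (m * norm1 (x - s))) \<partial>lborel)"
      by (intro nn_integral_cmult) measurable
    also have "\<dots> = ennreal (exp (m * norm1 s)) *
        (\<integral>\<^sup>+x. ennreal ((cmod (strip F (y - t) x))\<^sup>2 * exp (m * norm1 x)) \<partial>lborel)"
      by (subst nn_integral_translate[of "\<lambda>x. ennreal ((cmod (strip F (y - t) x))\<^sup>2 * exp (m * norm1 x))"]) auto
    also have "\<dots> \<le> ennreal (exp (m * norm1 s)) * ennreal M"
      using y norm1_diff[of y t] by (intro mult_left_mono M) auto
    also have "\<dots> = ennreal (exp (m * norm1 s) * M)"
      using \<open>0 \<le> M\<close> by (simp add: ennreal_mult)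
    finally show "(\<integral>\<^sup>+x. ennreal ((cmod (strip (\<lambda>z. F (fst z - a, snd z - b)) y x))\<^sup>2 * exp (m * norm1 x)) \<partial>lborel)
       \<le> ennreal (exp (m * norm1 s) * M)" .
  qed
qed

lemma entire_ext_eq:
  assumes "entire2 F" "extends F a"
  shows "entire_ext a = F"
  unfolding entire_ext_def
  using assms entire_extension_unique by blast

lemma algA_iff: "a \<in> algA \<longleftrightarrow> (\<exists>F. tame F \<and> extends F a)"
proof
  assume a: "a \<in> algA"
  then obtain F where F: "entire2 F" "extends F a"
    by (auto simp: algA_def)
  have F': "entire_ext a = F" by (rule entire_ext_eq[OF F])
  have "tame F"
  proof (rule tameI[OF F(1)])
    fix m r :: real assume m: "0 \<le> m" and r: "0 \<le> r"
    \<comment> \<open>The added 1 keeps \<mu> positive when \<open>m = 0\<close>, since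
      \<open>algA\<close> quantifies over positive parameters only.\<close>
    define \<mu> where "\<mu> = (m + 1) / (4 * pi)"
    have \<mu>: "\<mu> > 0" using m by (simp add: \<mu>_def)
    define \<Phi> where "\<Phi> = (\<lambda>(y1, y2). \<integral>\<^sup>+ (x1, x2). ennreal ((cmod (F (Complex x1 y1, Complex x2 y2)))\<^sup>2
               * exp (4 * pi * (\<mu> * \<bar>x1\<bar> + \<mu> * \<bar>x2\<bar>))) \<partial>lborel)"
    \<comment> \<open>Radius \<open>r + 1\<close> makes the open rectangle contain the closed ball
      of radius \<open>r\<close>.\<close>
    have fin: "(SUP y \<in> {y1. \<bar>y1\<bar> < r + 1} \<times> {y2. \<bar>y2\<bar> < r + 1}. \<Phi> y) < \<infinity>"
      using a \<mu> r unfolding algA_def mem_Collect_eq F' \<Phi>_def by (simp add: split_def)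
    define M where "M = enn2real (SUP y \<in> {y1. \<bar>y1\<bar> < r + 1} \<times> {y2. \<bar>y2\<bar> < r + 1}. \<Phi> y)"
    have M: "(SUP y \<in> {y1. \<bar>y1\<bar> < r + 1} \<times> {y2. \<bar>y2\<bar> < r + 1}. \<Phi> y) = ennreal M"
      using fin unfolding M_def by simp
    show "\<exists>M. \<forall>y. norm1 y \<le> r \<longrightarrow>
     (\<integral>\<^sup>+x. ennreal ((cmod (strip F y x))\<^sup>2 * exp (m * norm1 x)) \<partial>lborel) \<le> ennreal M"
    proof (intro exI allI impI)
      fix y assume y: "norm1 y \<le> r"
      have y': "y \<in> {y1. \<bar>y1\<bar> < r + 1} \<times> {y2. \<bar>y2\<bar> < r + 1}"
        using y by (cases y) (auto simp: norm1_def)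
      have "(\<integral>\<^sup>+x. ennreal ((cmod (strip F y x))\<^sup>2 * exp (m * norm1 x)) \<partial>lborel) \<le> \<Phi> y"
        unfolding \<Phi>_def split_def
      proof (intro nn_integral_mono ennreal_leI)
        fix x :: "real \<times> real"
        have "4 * pi * (\<mu> * \<bar>fst x\<bar> + \<mu> * \<bar>snd x\<bar>) = (m + 1) * norm1 x"
          by (simp add: \<mu>_def norm1_def field_simps)
        then show "(cmod (strip F y x))\<^sup>2 * exp (m * norm1 x)
          \<le> (cmod (F (Complex (fst x) (fst y), Complex (snd x) (snd y))))\<^sup>2 *
              exp (4 * pi * (\<mu> * \<bar>fst x\<bar> + \<mu> * \<bar>snd x\<bar>))"
          by (auto simp: strip_def intro!: mult_left_mono mult_right_mono)
      qed
      also have "\<dots> \<le> ennreal M"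
        unfolding M[symmetric] by (rule SUP_upper[OF y'])
      finally show "(\<integral>\<^sup>+x. ennreal ((cmod (strip F y x))\<^sup>2 * exp (m * norm1 x)) \<partial>lborel) \<le> ennreal M" .
    qed
  qed
  with F show "\<exists>F. tame F \<and> extends F a" by blast
next
  assume "\<exists>F. tame F \<and> extends F a"
  then obtain F where F: "tame F" "extends F a" by blast
  have F': "entire_ext a = F" by (rule entire_ext_eq[OF tame_entire2[OF F(1)] F(2)])
  show "a \<in> algA"
    unfolding algA_def mem_Collect_eq F'
  proof (intro conjI allI impI)
    show "\<exists>F. entire2 F \<and> extends F a" using F tame_entire2 by blast
    fix \<mu>1 \<mu>2 \<nu>1 \<nu>2 :: real
    \<comment> \<open>The larger of the two parameters dominates both weights, and the open
      rectangle lies in the ball of radius \<open>\<nu>1 + \<nu>2\<close>.\<close>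
    define m where "m = 4 * pi * max \<mu>1 \<mu>2"
    obtain M where M: "\<And>y. norm1 y \<le> \<nu>1 + \<nu>2 \<Longrightarrow>
     (\<integral>\<^sup>+x. ennreal ((cmod (strip F y x))\<^sup>2 * exp (m * norm1 x)) \<partial>lborel) \<le> ennreal M"
      using tameE[OF F(1), where r = "\<nu>1 + \<nu>2" and m = m] by blast
    have "(SUP (y1, y2)\<in>{y1. \<bar>y1\<bar> < \<nu>1} \<times> {y2. \<bar>y2\<bar> < \<nu>2}.
             \<integral>\<^sup>+ (x1, x2). ennreal ((cmod (F (Complex x1 y1, Complex x2 y2)))\<^sup>2 *
                  exp (4 * pi * (\<mu>1 * \<bar>x1\<bar> + \<mu>2 * \<bar>x2\<bar>))) \<partial>lborel) \<le> ennreal M"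
    proof (rule SUP_least, clarify)
      fix y1 y2 assume y: "\<bar>y1\<bar> < \<nu>1" "\<bar>y2\<bar> < \<nu>2"
      have "(\<integral>\<^sup>+ (x1, x2). ennreal ((cmod (F (Complex x1 y1, Complex x2 y2)))\<^sup>2 *
                  exp (4 * pi * (\<mu>1 * \<bar>x1\<bar> + \<mu>2 * \<bar>x2\<bar>))) \<partial>lborel)
          \<le> (\<integral>\<^sup>+x. ennreal ((cmod (strip F (y1, y2) x))\<^sup>2 * exp (m * norm1 x)) \<partial>lborel)"
        unfolding split_def
      proof (intro nn_integral_mono ennreal_leI)
        fix x :: "real \<times> real"
        have "\<mu>1 * \<bar>fst x\<bar> + \<mu>2 * \<bar>snd x\<bar> \<le> max \<mu>1 \<mu>2 * norm1 x"
          unfolding norm1_def distrib_left by (intro add_mono mult_right_mono) auto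
        then have "4 * pi * (\<mu>1 * \<bar>fst x\<bar> + \<mu>2 * \<bar>snd x\<bar>) \<le> m * norm1 x"
          unfolding m_def mult.assoc by (intro mult_left_mono) auto
        then show "(cmod (F (Complex (fst x) y1, Complex (snd x) y2)))\<^sup>2 *
                  exp (4 * pi * (\<mu>1 * \<bar>fst x\<bar> + \<mu>2 * \<bar>snd x\<bar>))
            \<le> (cmod (strip F (y1, y2) x))\<^sup>2 * exp (m * norm1 x)"
          by (auto simp: strip_def intro!: mult_left_mono)
      qed
      also have "\<dots> \<le> ennreal M"
        using y by (intro M) (simp add: norm1_def)
      finally show "(\<integral>\<^sup>+ (x1, x2). ennreal ((cmod (F (Complex x1 y1, Complex x2 y2)))\<^sup>2 *
                  exp (4 * pi * (\<mu>1 * \<bar>x1\<bar> + \<mu>2 * \<bar>x2\<bar>))) \<partial>lborel) \<le> ennreal M" .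
    qed
    also have "\<dots> < \<infinity>" by simp
    finally show "(SUP (y1, y2)\<in>{y1. \<bar>y1\<bar> < \<nu>1} \<times> {y2. \<bar>y2\<bar> < \<nu>2}.
             \<integral>\<^sup>+ (x1, x2). ennreal ((cmod (F (Complex x1 y1, Complex x2 y2)))\<^sup>2 *
                  exp (4 * pi * (\<mu>1 * \<bar>x1\<bar> + \<mu>2 * \<bar>x2\<bar>))) \<partial>lborel) < \<infinity>" .
  qed
qed

lemma integrable_exp_minus_abs: "integrable lborel (\<lambda>x::real. exp (- \<bar>x\<bar>))"
proof -
  have 1: "integrable lborel (\<lambda>x::real. indicator {0<..} x * exp (- x))"
    using integrable_I0i_exp_mscale[of 1] by (simp add: set_integrable_def)
  have 2: "integrable lborel (\<lambda>x::real. indicator {0<..} (- x) * exp (- (- x)))"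
    using lborel_integrable_real_affine[OF 1, of "-1" 0] by simp
  have "integrable lborel (\<lambda>x::real. indicator {0<..} x * exp (- x) + indicator {0<..} (- x) * exp (- (- x)))"
    by (rule Bochner_Integration.integrable_add[OF 1 2])
  then show ?thesis
  proof (rule integrable_cong_AE_imp)
    show "AE x::real in lborel. indicator {0<..} x * exp (- x) + indicator {0<..} (- x) * exp (- (- x)) = exp (- \<bar>x\<bar>)"
      by (rule AE_mp[OF AE_lborel_singleton[of "0::real"] AE_I2]) (auto simp: indicator_def)
  qed measurable
qed

lemma integrable_exp_minus_norm1: "integrable lborel (\<lambda>x. exp (- norm1 x))"
  using integrable_lborel_product[OF integrable_exp_minus_abs integrable_exp_minus_abs]
  by (simp add: norm1_def flip: exp_add)

lemma tame_integrable_sq: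
  assumes "tame F"
  shows "integrable lborel (\<lambda>x. (cmod (strip F y x))\<^sup>2 * exp (m * norm1 x))"
proof -
  note [measurable] = measurable_strip[OF tame_entire2[OF assms]]
  obtain M where "\<And>y'. norm1 y' \<le> norm1 y \<Longrightarrow>
     (\<integral>\<^sup>+x. ennreal ((cmod (strip F y' x))\<^sup>2 * exp (m * norm1 x)) \<partial>lborel) \<le> ennreal M"
    using tameE[OF assms, where r = "norm1 y" and m = m] by blast
  from this[OF order_refl] show ?thesis
    by (intro integrableI_bounded) (auto simp: top_unique less_top[symmetric])
qed

text \<open>L2 decay against every exponential weight gives L1 decay against every exponential
  weight: an extra \<open>exp (norm1 x / 2)\<close> is given to the function, and its inverse has
  the integrable square \<open>exp (- norm1 x)\<close>.\<close>

lemma tame_integrable_exp: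
  assumes "tame F"
  shows "integrable lborel (\<lambda>x. exp (m * norm1 x) * cmod (strip F y x))"
proof (rule Bochner_Integration.integrable_bound)
  note [measurable] = measurable_strip[OF tame_entire2[OF assms]]
  show "integrable lborel (\<lambda>x. (cmod (strip F y x))\<^sup>2 * exp ((2 * m + 1) * norm1 x) + exp (- norm1 x))"
    by (intro Bochner_Integration.integrable_add tame_integrable_sq assms integrable_exp_minus_norm1)
  show "AE x in lborel. norm (exp (m * norm1 x) * cmod (strip F y x))
     \<le> norm ((cmod (strip F y x))\<^sup>2 * exp ((2 * m + 1) * norm1 x) + exp (- norm1 x))"
  proof (rule AE_I2)
    fix x
    define p q where "p = cmod (strip F y x) * exp ((m + 1/2) * norm1 x)" and "q = exp (- (1/2) * norm1 x)"
    have "exp (m * norm1 x) * cmod (strip F y x) = p * q"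
      by (simp add: p_def q_def algebra_simps flip: exp_add)
    also have "\<dots> \<le> p\<^sup>2 + q\<^sup>2"
      using sum_squares_bound[of p q] zero_le_power2[of p] zero_le_power2[of q] by linarith
    also have "\<dots> = (cmod (strip F y x))\<^sup>2 * exp ((2 * m + 1) * norm1 x) + exp (- norm1 x)"
      by (simp add: p_def q_def power_mult_distrib algebra_simps flip: exp_double)
    finally show "norm (exp (m * norm1 x) * cmod (strip F y x))
     \<le> norm ((cmod (strip F y x))\<^sup>2 * exp ((2 * m + 1) * norm1 x) + exp (- norm1 x))"
      by simp
  qed
  show "(\<lambda>x. exp (m * norm1 x) * cmod (strip F y x)) \<in> borel_measurable lborel" by measurable
qed

lemma tame_integrable:
  assumes "tame F"
  shows "integrable lborel (strip F y)"
proof -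
  note [measurable] = measurable_strip[OF tame_entire2[OF assms]]
  have "integrable lborel (\<lambda>x. cmod (strip F y x))"
    using tame_integrable_exp[OF assms, of 0 y] by simp
  then show ?thesis
    by (subst (asm) integrable_norm_iff) simp_all
qed

section \<open>Contour shifts\<close>

text \<open>No pointwise decay at infinity is assumed, so the vertical sides of the rectangle need
  not tend to zero. If the two line integrals differed, the two vertical sides together would stay
  above a positive constant for all large \<open>R\<close>, and integrating over \<open>R\<close>
  would contradict the finiteness of the area integral \<open>fin\<close>.\<close>

lemma contour_shift_real:
  fixes f :: "complex \<Rightarrow> complex"
  assumes f: "f holomorphic_on UNIV" and pq: "p \<le> q"
    and ip: "integrable lborel (\<lambda>t. f (Complex t p))"
    and iq: "integrable lborel (\<lambda>t. f (Complex t q))"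
    and fin: "(\<integral>\<^sup>+t. (\<integral>\<^sup>+s. indicator {p..q} s * ennreal (cmod (f (Complex t s))) \<partial>lborel) \<partial>lborel) < \<infinity>"
  shows "(LINT t|lborel. f (Complex t p)) = (LINT t|lborel. f (Complex t q))"
proof (rule ccontr)
  obtain P where P: "\<And>z. (P has_field_derivative f z) (at z)"
    using holomorphic_convex_primitive'[OF convex_UNIV open_UNIV f] by (metis UNIV_I)
  have cf: "continuous_on UNIV f" by (rule holomorphic_on_imp_continuous_on[OF f])
  have cont: "continuous_on S (\<lambda>s. f (Complex t s))" "continuous_on S (\<lambda>t. f (Complex t s))" for S s t
    unfolding Complex_eq by (intro continuous_intros continuous_on_compose2[OF cf]; simp)+
  \<comment> \<open>\<open>v t\<close> bounds the contribution of the vertical side at abscissa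
    \<open>t\<close>; its integral over \<open>t\<close> is the quantity in
    \<open>fin\<close>.\<close>
  define v where "v t = (LINT s|lborel. indicator {p..q} s *\<^sub>R cmod (f (Complex t s)))" for t
  have iv: "integrable lborel (\<lambda>s. indicator {p..q} s *\<^sub>R cmod (f (Complex t s)))" for t
    by (intro borel_integrable_compact compact_Icc continuous_intros cont)
  have v: "ennreal (v t) = (\<integral>\<^sup>+s. indicator {p..q} s * ennreal (cmod (f (Complex t s))) \<partial>lborel)" for t
    unfolding v_def
    by (subst nn_integral_eq_integral[OF iv, symmetric]) (auto intro!: nn_integral_cong simp: indicator_def)
  have v0: "0 \<le> v t" for t
    unfolding v_def by (intro Bochner_Integration.integral_nonneg) auto
  have vert: "cmod (P (Complex t q) - P (Complex t p)) \<le> v t" for t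
  proof -
    have "(LINT s|lborel. indicator {p..q} s *\<^sub>R (\<i> * f (Complex t s))) = P (Complex t q) - P (Complex t p)"
    proof (rule integral_FTC_atLeastAtMost[OF pq])
      show "continuous_on {p..q} (\<lambda>s. \<i> * f (Complex t s))" by (intro continuous_intros cont)
      fix s
      have "((\<lambda>s. Complex t s) has_vector_derivative \<i>) (at s within {p..q})"
        unfolding Complex_eq by (auto intro!: derivative_eq_intros)
      from field_vector_diff_chain_within[OF this, of P "f (Complex t s)"]
      show "((\<lambda>s. P (Complex t s)) has_vector_derivative \<i> * f (Complex t s)) (at s within {p..q})"
        using P by (auto simp: o_def intro: has_field_derivative_at_within)
    qed
    then have "P (Complex t q) - P (Complex t p) = (LINT s|lborel. indicator {p..q} s *\<^sub>R (\<i> * f (Complex t s)))" ..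
    also have "cmod \<dots> \<le> (LINT s|lborel. cmod (indicator {p..q} s *\<^sub>R (\<i> * f (Complex t s))))"
      by (rule integral_norm_bound)
    also have "\<dots> = v t" unfolding v_def by (simp add: norm_mult)
    finally show ?thesis .
  qed
  have hor: "(LINT t|lborel. indicator {-R..R} t *\<^sub>R f (Complex t s)) = P (Complex R s) - P (Complex (-R) s)"
    if "0 \<le> R" for R s
  proof (rule integral_FTC_atLeastAtMost)
    show "continuous_on {-R..R} (\<lambda>t. f (Complex t s))" by (rule cont)
    fix t
    have "((\<lambda>t. Complex t s) has_vector_derivative 1) (at t within {-R..R})"
      unfolding Complex_eq by (auto intro!: derivative_eq_intros)
    from field_vector_diff_chain_within[OF this, of P "f (Complex t s)"]
    show "((\<lambda>t. P (Complex t s)) has_vector_derivative f (Complex t s)) (at t within {-R..R})"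
      using P by (auto simp: o_def intro: has_field_derivative_at_within)
  qed (use that in simp)
  have lim: "((\<lambda>R. LINT t|lborel. indicator {-R..R} t *\<^sub>R f (Complex t s)) \<longlongrightarrow> (LINT t|lborel. f (Complex t s))) at_top"
    if "integrable lborel (\<lambda>t. f (Complex t s))" for s
  proof (rule integral_dominated_convergence_at_top)
    show "integrable lborel (\<lambda>t. cmod (f (Complex t s)))" using that by simp
    show "(\<lambda>t. f (Complex t s)) \<in> borel_measurable lborel"
      using that by simp
    then show "(\<lambda>t. indicator {-R..R} t *\<^sub>R f (Complex t s)) \<in> borel_measurable lborel" for R
      by simp
    have "((\<lambda>R. indicator {-R..R} t *\<^sub>R f (Complex t s)) \<longlongrightarrow> f (Complex t s)) at_top" for t
    proof (rule tendsto_eventually)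
      show "\<forall>\<^sub>F R in at_top. indicator {-R..R} t *\<^sub>R f (Complex t s) = f (Complex t s)"
        using eventually_ge_at_top[of "\<bar>t\<bar>"] by eventually_elim (auto simp: indicator_def abs_le_iff)
    qed
    then show "AE t in lborel. ((\<lambda>R. indicator {-R..R} t *\<^sub>R f (Complex t s)) \<longlongrightarrow> f (Complex t s)) at_top" by simp
    show "\<forall>\<^sub>F R in at_top. AE t in lborel. cmod (indicator {-R..R} t *\<^sub>R f (Complex t s)) \<le> cmod (f (Complex t s))"
      by (auto simp: indicator_def)
  qed
  assume neq: "(LINT t|lborel. f (Complex t p)) \<noteq> (LINT t|lborel. f (Complex t q))"
  \<comment> \<open>Half of the gap, so that the truncated integrals eventually differ by more than
    \<open>e\<close>.\<close>
  define e where "e = cmod ((LINT t|lborel. f (Complex t p)) - (LINT t|lborel. f (Complex t q))) / 2"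
  have e: "e > 0" using neq by (simp add: e_def)
  have "((\<lambda>R. cmod ((LINT t|lborel. indicator {-R..R} t *\<^sub>R f (Complex t p)) -
      (LINT t|lborel. indicator {-R..R} t *\<^sub>R f (Complex t q)))) \<longlongrightarrow> 2 * e) at_top"
    using tendsto_norm[OF tendsto_diff[OF lim[OF ip] lim[OF iq]]] by (simp add: e_def)
  then have "\<forall>\<^sub>F R in at_top. e < cmod ((LINT t|lborel. indicator {-R..R} t *\<^sub>R f (Complex t p)) -
      (LINT t|lborel. indicator {-R..R} t *\<^sub>R f (Complex t q)))"
    by (rule order_tendstoD) (use e in simp)
  then have "\<forall>\<^sub>F R in at_top. e < v R + v (- R)"
    using eventually_ge_at_top[of 0]
  proof eventually_elim
    case (elim R)
    have "e < cmod ((P (Complex R p) - P (Complex (-R) p)) - (P (Complex R q) - P (Complex (-R) q)))"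
      using elim by (simp add: hor)
    also have "\<dots> = cmod ((P (Complex (-R) q) - P (Complex (-R) p)) - (P (Complex R q) - P (Complex R p)))"
      by (rule arg_cong[of _ _ cmod]) simp
    also have "\<dots> \<le> v (- R) + v R"
      by (rule order_trans[OF norm_triangle_ineq4]) (intro add_mono vert)
    finally show ?case by simp
  qed
  then obtain R0 where R0: "\<And>R. R \<ge> R0 \<Longrightarrow> e < v R + v (- R)"
    by (auto simp: eventually_at_top_linorder)
  have [measurable]: "(\<lambda>z. ennreal (cmod (f z))) \<in> borel_measurable borel"
    using cf by (intro measurable_compose[OF borel_measurable_continuous_onI measurable_ennreal] continuous_intros) auto
  have [measurable]: "(\<lambda>x. Complex (fst x) (snd x)) \<in> borel_measurable borel"
    unfolding Complex_eq by (intro borel_measurable_continuous_onI continuous_intros)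
  have "(\<lambda>x. ennreal (cmod (f (Complex (fst x) (snd x))))) \<in> borel_measurable borel"
    by measurable
  then have [measurable]: "(\<lambda>x. ennreal (cmod (f (Complex (fst x) (snd x))))) \<in> borel_measurable (lborel \<Otimes>\<^sub>M lborel)"
    by (simp add: lborel_prod)
  have mv [measurable]: "(\<lambda>t. ennreal (v t)) \<in> borel_measurable borel"
  proof -
    have "(\<lambda>t. \<integral>\<^sup>+s. (\<lambda>x. indicator {p..q} (snd x) * ennreal (cmod (f (Complex (fst x) (snd x))))) (t, s) \<partial>lborel)
        \<in> borel_measurable lborel"
      by (intro lborel.borel_measurable_nn_integral_fst) measurable
    then show ?thesis by (simp add: v)
  qed
  have "\<infinity> = (\<integral>\<^sup>+t. ennreal e * indicator {R0..} t \<partial>lborel)"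
  proof -
    have "(\<integral>\<^sup>+t. ennreal e * indicator {R0..} t \<partial>lborel) \<ge> ennreal e * of_nat n" for n
    proof -
      have "ennreal e * of_nat n = (\<integral>\<^sup>+t. ennreal e * indicator {R0..R0 + real n} t \<partial>lborel)"
        by (subst nn_integral_cmult_indicator) (auto simp: ennreal_of_nat_eq_real_of_nat)
      also have "\<dots> \<le> (\<integral>\<^sup>+t. ennreal e * indicator {R0..} t \<partial>lborel)"
        by (intro nn_integral_mono mult_left_mono) (auto simp: indicator_def)
      finally show ?thesis .
    qed
    then have "(\<integral>\<^sup>+t. ennreal e * indicator {R0..} t \<partial>lborel) \<ge> (SUP n. ennreal e * of_nat n)"
      by (intro SUP_least)
    also have "(SUP n. ennreal e * of_nat n) = \<infinity>"
      using e by (simp add: SUP_mult_left_ennreal[symmetric] ennreal_SUP_of_nat_eq_top ennreal_mult_top)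
    finally show ?thesis by (simp add: top_unique)
  qed
  also have "\<dots> \<le> (\<integral>\<^sup>+t. ennreal (v t) + ennreal (v (- t)) \<partial>lborel)"
  proof (rule nn_integral_mono)
    fix t
    show "ennreal e * indicator {R0..} t \<le> ennreal (v t) + ennreal (v (- t))"
      using R0[of t] v0 by (auto simp: indicator_def simp flip: ennreal_plus intro!: ennreal_leI)
  qed
  also have "\<dots> = (\<integral>\<^sup>+t. ennreal (v t) \<partial>lborel) + (\<integral>\<^sup>+t. ennreal (v (- t)) \<partial>lborel)"
    by (intro nn_integral_add) (auto intro: measurable_compose[OF _ mv])
  also have "(\<integral>\<^sup>+t. ennreal (v (- t)) \<partial>lborel) = (\<integral>\<^sup>+t. ennreal (v t) \<partial>lborel)"
    using nn_integral_real_affine[OF mv, of "-1" 0] by simp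
  also have "(\<integral>\<^sup>+t. ennreal (v t) \<partial>lborel) + (\<integral>\<^sup>+t. ennreal (v t) \<partial>lborel) < \<infinity>"
    using fin by (simp add: v)
  finally show False by simp
qed

lemma strip_swap: "strip (\<lambda>z. K (snd z, fst z)) y x = strip K (snd y, fst y) (snd x, fst x)"
  by (simp add: strip_def)

text \<open>The second variable is a parameter. The hypotheses are integrals over the plane, so the
  one-variable shift is justified only for almost every value of it, which is enough under the outer
  integral.\<close>

lemma contour_shift_fst:
  assumes K: "entire2 K" and pq: "p \<le> q"
    and ip: "integrable lborel (strip K (p, b))" and iq: "integrable lborel (strip K (q, b))"
    and M: "\<And>s. p \<le> s \<Longrightarrow> s \<le> q \<Longrightarrow> (\<integral>\<^sup>+x. ennreal (cmod (strip K (s, b) x)) \<partial>lborel) \<le> ennreal M"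
  shows "(LINT x|lborel. strip K (p, b) x) = (LINT x|lborel. strip K (q, b) x)"
proof -
  define f where "f t z = K (z, Complex t b)" for t z
  have strip_f: "strip K (s, b) (t, t') = f t' (Complex t s)" for s t t'
    by (simp add: f_def strip_def)
  define G where "G = (\<lambda>u :: (real \<times> real) \<times> real.
    indicator {p..q} (snd u) * ennreal (cmod (K (Complex (fst (fst u)) (snd u), Complex (snd (fst u)) b))))"
  have "continuous_on UNIV (\<lambda>u :: (real \<times> real) \<times> real. K (Complex (fst (fst u)) (snd u), Complex (snd (fst u)) b))"
    unfolding Complex_eq
    by (intro continuous_intros continuous_on_compose2[OF entire2_continuous_on[OF K, of UNIV]]) auto
  then have [measurable]: "(\<lambda>u :: (real \<times> real) \<times> real. K (Complex (fst (fst u)) (snd u), Complex (snd (fst u)) b)) \<in> borel_measurable borel"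
    by (rule borel_measurable_continuous_onI)
  have G [measurable]: "G \<in> borel_measurable (lborel \<Otimes>\<^sub>M lborel)"
    unfolding G_def lborel_prod by measurable
  define H where "H x = (\<integral>\<^sup>+s. G (x, s) \<partial>lborel)" for x
  have mH: "H \<in> borel_measurable lborel"
    unfolding H_def by (rule lborel.borel_measurable_nn_integral_fst[OF G])
  then have mH': "H \<in> borel_measurable (lborel \<Otimes>\<^sub>M lborel)"
    by (simp add: lborel_prod)
  \<comment> \<open>Tonelli moves the integral over the height \<open>s\<close> outside, where the
    bound uniform in \<open>s\<close> gives at most \<open>M\<close> times \<open>q - p\<close>.
    Hence the area integral is finite for almost every \<open>t'\<close>.\<close>
  have "(\<integral>\<^sup>+t'. (\<integral>\<^sup>+t. H (t, t') \<partial>lborel) \<partial>lborel) = (\<integral>\<^sup>+x. H x \<partial>lborel)"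
    using lborel_pair.nn_integral_snd[OF mH'] by (simp add: lborel_prod)
  also have "\<dots> = (\<integral>\<^sup>+s. (\<integral>\<^sup>+x. G (x, s) \<partial>lborel) \<partial>lborel)"
    unfolding H_def by (rule lborel_pair.Fubini[OF G, symmetric])
  also have "\<dots> \<le> (\<integral>\<^sup>+s. ennreal M * indicator {p..q} s \<partial>lborel)"
  proof (rule nn_integral_mono)
    fix s
    show "(\<integral>\<^sup>+x. G (x, s) \<partial>lborel) \<le> ennreal M * indicator {p..q} s"
      using M[of s] by (cases "s \<in> {p..q}") (auto simp: G_def strip_def)
  qed
  also have "\<dots> < \<infinity>"
    using pq by (subst nn_integral_cmult_indicator) (auto simp: ennreal_mult_less_top)
  finally have "(\<integral>\<^sup>+t'. (\<integral>\<^sup>+t. H (t, t') \<partial>lborel) \<partial>lborel) \<noteq> \<infinity>" by simp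
  moreover have "(\<lambda>t'. \<integral>\<^sup>+t. H (t, t') \<partial>lborel) \<in> borel_measurable lborel"
    using lborel.borel_measurable_nn_integral_fst[OF measurable_pair_swap[OF mH']] by simp
  ultimately have AEH: "AE t' in lborel. (\<integral>\<^sup>+t. H (t, t') \<partial>lborel) \<noteq> \<infinity>"
    by (rule nn_integral_PInf_AE[rotated])
  have ip': "integrable (lborel \<Otimes>\<^sub>M lborel) (\<lambda>(t, t'). f t' (Complex t p))"
    and iq': "integrable (lborel \<Otimes>\<^sub>M lborel) (\<lambda>(t, t'). f t' (Complex t q))"
    using ip iq by (simp_all add: strip_f lborel_prod split_def flip: strip_f)
  have AE: "AE t' in lborel. (LINT t|lborel. f t' (Complex t p)) = (LINT t|lborel. f t' (Complex t q))"
    using AEH lborel_pair.AE_integrable_snd[OF ip'] lborel_pair.AE_integrable_snd[OF iq']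
  proof eventually_elim
    case (elim t')
    show ?case
    proof (rule contour_shift_real[OF _ pq elim(2,3)])
      show "f t' holomorphic_on UNIV"
        unfolding f_def by (rule entire2_holomorphic_fst[OF K])
      show "(\<integral>\<^sup>+t. \<integral>\<^sup>+s. indicator {p..q} s * ennreal (cmod (f t' (Complex t s))) \<partial>lborel \<partial>lborel) < \<infinity>"
        using elim(1) by (simp add: H_def G_def f_def less_top)
    qed
  qed
  have "(LINT x|lborel. strip K (p, b) x) = (LINT t'|lborel. LINT t|lborel. f t' (Complex t p))"
    by (subst lborel_pair.integral_snd[OF ip']) (simp add: lborel_prod split_def flip: strip_f)
  also have "\<dots> = (LINT t'|lborel. LINT t|lborel. f t' (Complex t q))"
    using AE lborel_pair.integrable_snd[OF ip'] lborel_pair.integrable_snd[OF iq']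
    by (intro integral_cong_AE) simp_all
  also have "\<dots> = (LINT x|lborel. strip K (q, b) x)"
    by (subst lborel_pair.integral_snd[OF iq']) (simp add: lborel_prod split_def flip: strip_f)
  finally show ?thesis .
qed

lemma contour_shift_fst':
  assumes K: "entire2 K"
    and bd: "\<And>r. \<exists>M. \<forall>y. norm1 y \<le> r \<longrightarrow> (\<integral>\<^sup>+x. ennreal (cmod (strip K y x)) \<partial>lborel) \<le> ennreal M"
  shows "(LINT x|lborel. strip K (p, b) x) = (LINT x|lborel. strip K (q, b) x)"
proof -
  note [measurable] = measurable_strip[OF K]
  have int: "integrable lborel (strip K y)" for y
  proof (rule integrableI_bounded)
    obtain M where "\<forall>y'. norm1 y' \<le> norm1 y \<longrightarrow> (\<integral>\<^sup>+x. ennreal (cmod (strip K y' x)) \<partial>lborel) \<le> ennreal M"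
      using bd by blast
    then have "(\<integral>\<^sup>+x. ennreal (cmod (strip K y x)) \<partial>lborel) \<le> ennreal M" by blast
    then show "(\<integral>\<^sup>+x. ennreal (cmod (strip K y x)) \<partial>lborel) < \<infinity>"
      by (rule le_less_trans) simp
  qed measurable
  have *: "(LINT x|lborel. strip K (p, b) x) = (LINT x|lborel. strip K (q, b) x)" if "p \<le> q" for p q
  proof -
    obtain M where "\<forall>y. norm1 y \<le> \<bar>p\<bar> + \<bar>q\<bar> + \<bar>b\<bar> \<longrightarrow> (\<integral>\<^sup>+x. ennreal (cmod (strip K y x)) \<partial>lborel) \<le> ennreal M"
      using bd by blast
    then have M: "(\<integral>\<^sup>+x. ennreal (cmod (strip K y x)) \<partial>lborel) \<le> ennreal M"
      if "norm1 y \<le> \<bar>p\<bar> + \<bar>q\<bar> + \<bar>b\<bar>" for y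
      using that by blast
    show ?thesis
    proof (rule contour_shift_fst[OF K that int int])
      fix s assume "p \<le> s" "s \<le> q"
      then have "norm1 (s, b) \<le> \<bar>p\<bar> + \<bar>q\<bar> + \<bar>b\<bar>" by (simp add: norm1_def)
      then show "(\<integral>\<^sup>+x. ennreal (cmod (strip K (s, b) x)) \<partial>lborel) \<le> ennreal M" by (rule M)
    qed
  qed
  show ?thesis
    using *[of p q] *[of q p, symmetric] linear[of p q] by blast
qed

text \<open>One coordinate is moved at a time; the second shift is the first one applied to
  \<open>K\<close> with its arguments exchanged.\<close>

lemma contour_shift_plane:
  assumes K: "entire2 K"
    and bd: "\<And>r. \<exists>M. \<forall>y. norm1 y \<le> r \<longrightarrow> (\<integral>\<^sup>+x. ennreal (cmod (strip K y x)) \<partial>lborel) \<le> ennreal M"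
  shows "(LINT x|lborel. strip K y x) = (LINT x|lborel. strip K y' x)"
proof -
  define K' where "K' = (\<lambda>z. K (snd z, fst z))"
  have K': "entire2 K'" unfolding K'_def by (rule entire2_swap[OF K])
  have strip': "strip K' y x = strip K (snd y, fst y) (snd x, fst x)" for x y
    unfolding K'_def by (rule strip_swap)
  note [measurable] = measurable_strip[OF K]
  have bd': "\<exists>M. \<forall>y. norm1 y \<le> r \<longrightarrow> (\<integral>\<^sup>+x. ennreal (cmod (strip K' y x)) \<partial>lborel) \<le> ennreal M" for r
  proof -
    obtain M where M: "\<forall>y. norm1 y \<le> r \<longrightarrow> (\<integral>\<^sup>+x. ennreal (cmod (strip K y x)) \<partial>lborel) \<le> ennreal M"
      using bd by blast
    show ?thesis
    proof (intro exI allI impI)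
      fix y assume y: "norm1 y \<le> r"
      have "(\<integral>\<^sup>+x. ennreal (cmod (strip K' y x)) \<partial>lborel) = (\<integral>\<^sup>+x. ennreal (cmod (strip K (snd y, fst y) x)) \<partial>lborel)"
        unfolding strip' by (rule nn_integral_plane_swap) measurable
      also have "\<dots> \<le> ennreal M" using M y by (auto simp: norm1_def)
      finally show "(\<integral>\<^sup>+x. ennreal (cmod (strip K' y x)) \<partial>lborel) \<le> ennreal M" .
    qed
  qed
  have snd: "(LINT x|lborel. strip K (b, p) x) = (LINT x|lborel. strip K (b, q) x)" for b p q
    using contour_shift_fst'[OF K' bd', of p b q]
    by (simp add: strip' integral_plane_swap)
  show ?thesis
    using contour_shift_fst'[OF K bd, of "fst y" "snd y" "fst y'"] snd[of "fst y'" "snd y" "snd y'"] by simp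
qed

section \<open>Functionals bounded by a Hilbert norm\<close>

definition l2_inner :: "plane_fun \<Rightarrow> plane_fun \<Rightarrow> complex" where
  "l2_inner f g = (LINT x|lborel. cnj (f x) * g x)"

definition square_integrable :: "plane_fun \<Rightarrow> bool" where
  "square_integrable f \<longleftrightarrow> f \<in> borel_measurable borel \<and> integrable lborel (\<lambda>x. (cmod (f x))\<^sup>2)"

lemma norm_L2_nonneg [simp]: "0 \<le> norm_L2 f"
  unfolding norm_L2_def by (intro real_sqrt_ge_zero Bochner_Integration.integral_nonneg) auto

lemma norm_L2_power2: "(norm_L2 f)\<^sup>2 = (LINT x|lborel. (cmod (f x))\<^sup>2)"
  unfolding norm_L2_def by (intro real_sqrt_pow2 Bochner_Integration.integral_nonneg) auto

lemma square_integrable_mult: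
  assumes "square_integrable f" "square_integrable g"
  shows "integrable lborel (\<lambda>x. cnj (f x) * g x)"
proof (rule Bochner_Integration.integrable_bound)
  have [measurable]: "f \<in> borel_measurable borel" "g \<in> borel_measurable borel"
    using assms by (auto simp: square_integrable_def)
  show "(\<lambda>x. cnj (f x) * g x) \<in> borel_measurable lborel" by measurable
  show "integrable lborel (\<lambda>x. (cmod (f x))\<^sup>2 + (cmod (g x))\<^sup>2)"
    using assms by (auto simp: square_integrable_def)
  show "AE x in lborel. cmod (cnj (f x) * g x) \<le> norm ((cmod (f x))\<^sup>2 + (cmod (g x))\<^sup>2)"
  by (rule AE_I2) (simp add: norm_mult mult_le_sum_squares)
qed

lemma norm_L2_add_scaled:
  assumes "square_integrable f" "square_integrable g"
  shows "(norm_L2 (\<lambda>x. f x + r * g x))\<^sup>2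
    = (norm_L2 f)\<^sup>2 + 2 * Re (r * l2_inner f g) + (cmod r)\<^sup>2 * (norm_L2 g)\<^sup>2"
proof -
  note int = square_integrable_mult[OF assms]
  have "(norm_L2 (\<lambda>x. f x + r * g x))\<^sup>2
      = (LINT x|lborel. (cmod (f x))\<^sup>2 + 2 * Re (r * (cnj (f x) * g x)) + (cmod r)\<^sup>2 * (cmod (g x))\<^sup>2)"
    unfolding norm_L2_power2
  proof (rule Bochner_Integration.integral_cong[OF refl])
    fix x
    show "(cmod (f x + r * g x))\<^sup>2
       = (cmod (f x))\<^sup>2 + 2 * Re (r * (cnj (f x) * g x)) + (cmod r)\<^sup>2 * (cmod (g x))\<^sup>2"
      unfolding cmod_power2 by (simp add: power2_eq_square algebra_simps)
  qed
  also have "\<dots> = (LINT x|lborel. (cmod (f x))\<^sup>2) + 2 * (LINT x|lborel. Re (r * (cnj (f x) * g x)))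
      + (cmod r)\<^sup>2 * (LINT x|lborel. (cmod (g x))\<^sup>2)"
  proof -
    have "(LINT x|lborel. A x + 2 * B x + s * D x)
        = (LINT x|lborel. A x) + 2 * (LINT x|lborel. B x) + s * (LINT x|lborel. D x)"
      if "integrable lborel A" "integrable lborel B" "integrable lborel D"
      for A B D :: "real \<times> real \<Rightarrow> real" and s
      using that by simp
    from this[OF _ integrable_Re[OF integrable_mult_right[OF int]]] show ?thesis
      using assms by (simp add: square_integrable_def)
  qed
  also have "(LINT x|lborel. Re (r * (cnj (f x) * g x))) = Re (r * l2_inner f g)"
    unfolding l2_inner_def using int
    by (subst integral_Re) simp_all
  finally show ?thesis by (simp add: norm_L2_power2)
qed

text \<open>A substitute for the Riesz representation theorem without completeness: the representing
  vector is a near-minimiser of \<open>\<parallel>T v\<parallel>\<^sup>2 - 2 Re (h v)\<close>.\<close>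

lemma approximate_riesz:
  fixes V :: "plane_fun set" and T :: "plane_fun \<Rightarrow> plane_fun" and h :: "plane_fun \<Rightarrow> complex"
  assumes V: "V \<noteq> {}" "\<And>a b r. a \<in> V \<Longrightarrow> b \<in> V \<Longrightarrow> (\<lambda>x. a x + r * b x) \<in> V"
    and T: "\<And>a b r. a \<in> V \<Longrightarrow> b \<in> V \<Longrightarrow> T (\<lambda>x. a x + r * b x) = (\<lambda>x. T a x + r * T b x)"
    and h: "\<And>a b r. a \<in> V \<Longrightarrow> b \<in> V \<Longrightarrow> h (\<lambda>x. a x + r * b x) = h a + r * h b"
    and sq: "\<And>a. a \<in> V \<Longrightarrow> square_integrable (T a)"
    and bound: "\<And>a. a \<in> V \<Longrightarrow> cmod (h a) \<le> C * norm_L2 (T a)"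
    and \<epsilon>: "\<epsilon> > 0"
  obtains v where "v \<in> V" "\<And>b. b \<in> V \<Longrightarrow> cmod (l2_inner (T v) (T b) - h b) \<le> \<epsilon> * norm_L2 (T b)"
proof -
  define J where "J v = (norm_L2 (T v))\<^sup>2 - 2 * Re (h v)" for v
  \<comment> \<open>Completing the square: with \<open>N = norm_L2 (T v)\<close> one has
    \<open>J v \<ge> N^2 - 2 * C * N \<ge> - C^2\<close>.\<close>
  have bdd: "bdd_below (J ` V)"
  proof (rule bdd_belowI2)
    fix v assume v: "v \<in> V"
    have "Re (h v) \<le> C * norm_L2 (T v)"
      using bound[OF v] complex_Re_le_cmod[of "h v"] by linarith
    moreover have "0 \<le> (norm_L2 (T v) - C)\<^sup>2" by simp
    ultimately show "- (C\<^sup>2) \<le> J v"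
      unfolding J_def power2_diff by (simp add: algebra_simps)
  qed
  have "Inf (J ` V) < Inf (J ` V) + \<epsilon>\<^sup>2" using \<epsilon> by simp
  then obtain v where v: "v \<in> V" and Jv: "J v < Inf (J ` V) + \<epsilon>\<^sup>2"
    using cInf_lessD[of "J ` V"] V(1) by blast
  show ?thesis
  proof (rule that[OF v])
    fix b assume b: "b \<in> V"
    define \<rho> where "\<rho> = l2_inner (T v) (T b) - h b"
    define N where "N = norm_L2 (T b)"
    have key: "2 * s * (cmod \<rho>)\<^sup>2 - s\<^sup>2 * (cmod \<rho>)\<^sup>2 * N\<^sup>2 \<le> \<epsilon>\<^sup>2" for s :: real
    proof -
      \<comment> \<open>The perturbation of \<open>v\<close> along \<open>b\<close> has the phase
        that makes \<open>Re (r * \<rho>)\<close> equal to \<open>- s * (cmod \<rho>)^2\<close>;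
        near-minimality allows \<open>J\<close> to drop by at most
        \<open>\<epsilon>^2\<close>.\<close>
      define r where "r = - of_real s * cnj \<rho>"
      have "J v - \<epsilon>\<^sup>2 \<le> J (\<lambda>x. v x + r * b x)"
        using cInf_lower[OF imageI[OF V(2)[OF v b, of r]] bdd] Jv by linarith
      also have "\<dots> = J v + 2 * Re (r * \<rho>) + (cmod r)\<^sup>2 * N\<^sup>2"
        unfolding J_def T[OF v b] h[OF v b] norm_L2_add_scaled[OF sq[OF v] sq[OF b]] N_def \<rho>_def
        by (simp add: algebra_simps)
      also have "Re (r * \<rho>) = - s * (cmod \<rho>)\<^sup>2"
        unfolding r_def cmod_power2 by (simp add: power2_eq_square algebra_simps)
      also have "(cmod r)\<^sup>2 = s\<^sup>2 * (cmod \<rho>)\<^sup>2"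
        by (simp add: r_def norm_mult power_mult_distrib)
      finally show ?thesis by (simp add: algebra_simps)
    qed
    have "cmod \<rho> \<le> \<epsilon> * N"
    proof (cases "N = 0")
      case True
      \<comment> \<open>Without the quadratic term \<open>key\<close> is linear in \<open>s\<close>;
        the chosen \<open>s\<close> would give
        \<open>2 * \<epsilon>^2 \<le> \<epsilon>^2\<close>.\<close>
      have "\<rho> = 0"
      proof (rule ccontr)
        assume "\<rho> \<noteq> 0"
        then show False
          using key[of "\<epsilon>\<^sup>2 / (cmod \<rho>)\<^sup>2"] \<epsilon> True by simp
      qed
      with True show ?thesis by simp
    next
      case False
      then have N: "N > 0" by (simp add: N_def less_le)
      \<comment> \<open>The value \<open>s = 1 / N^2\<close> maximises the left-hand side of
        \<open>key\<close>.\<close>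
      have "2 * (1 / N\<^sup>2) * (cmod \<rho>)\<^sup>2 - (1 / N\<^sup>2)\<^sup>2 * (cmod \<rho>)\<^sup>2 * N\<^sup>2 = (cmod \<rho>)\<^sup>2 / N\<^sup>2"
        using N by (simp add: field_simps power2_eq_square)
      then have "(cmod \<rho>)\<^sup>2 \<le> \<epsilon>\<^sup>2 * N\<^sup>2"
        using key[of "1 / N\<^sup>2"] N by (simp only: pos_divide_le_eq[of "N\<^sup>2"] zero_less_power)
      then have "(cmod \<rho>)\<^sup>2 \<le> (\<epsilon> * N)\<^sup>2" by (simp add: power_mult_distrib)
      then show ?thesis
        by (rule power2_le_imp_le) (use \<epsilon> N in simp)
    qed
    then show "cmod (l2_inner (T v) (T b) - h b) \<le> \<epsilon> * norm_L2 (T b)"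
      by (simp add: \<rho>_def N_def)
  qed
qed

section \<open>The norm bound and covariant functionals\<close>

definition weight :: "real \<times> real \<Rightarrow> real \<times> real \<Rightarrow> real" where
  "weight c x = (exp (fst c * fst x) + exp (- (fst c * fst x))) * (exp (snd c * snd x) + exp (- (snd c * snd x)))"

lemma weight_pos [simp]: "0 < weight c x"
  unfolding weight_def by (intro mult_pos_pos add_pos_pos) simp_all

lemma weight_nonneg [simp]: "0 \<le> weight c x"
  by (rule less_imp_le) simp

lemma measurable_weight [measurable]: "weight c \<in> borel_measurable borel"
  unfolding weight_def by measurable

text \<open>In each coordinate the product of the two sums of exponentials expands into the wanted
  terms plus positive ones. This is what bounds the cost of a translation.\<close>

lemma weight_add: "weight c (x + u) \<le> weight c x * weight c u"
proof -
  have *: "exp (s + t) + exp (- (s + t)) \<le> (exp s + exp (- s)) * (exp t + exp (- t))" for s t :: real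
  proof -
    have "(exp s + exp (- s)) * (exp t + exp (- t))
        = exp (s + t) + exp (- (s + t)) + (exp (s - t) + exp (t - s))"
      by (simp add: algebra_simps flip: exp_add)
    then show ?thesis by (simp add: add_nonneg_nonneg)
  qed
  have "weight c (x + u) = (exp (fst c * fst x + fst c * fst u) + exp (- (fst c * fst x + fst c * fst u)))
     * (exp (snd c * snd x + snd c * snd u) + exp (- (snd c * snd x + snd c * snd u)))"
    by (simp only: weight_def fst_add snd_add distrib_left)
  also have "\<dots> \<le> ((exp (fst c * fst x) + exp (- (fst c * fst x))) * (exp (fst c * fst u) + exp (- (fst c * fst u))))
     * ((exp (snd c * snd x) + exp (- (snd c * snd x))) * (exp (snd c * snd u) + exp (- (snd c * snd u))))"
    by (intro mult_mono[OF * *] mult_nonneg_nonneg add_nonneg_nonneg exp_ge_zero)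
  finally show ?thesis by (simp only: weight_def mult_ac)
qed

lemma weight_le_diff: "weight c x \<le> weight c u * weight c (x - u)"
  using weight_add[of c u "x - u"] by simp

lemma weight_power_le: "weight c x ^ n \<le> 4 ^ n * exp (real n * (\<bar>fst c\<bar> + \<bar>snd c\<bar>) * norm1 x)"
proof -
  have *: "exp (s * t) + exp (- (s * t)) \<le> 2 * exp (\<bar>s\<bar> * \<bar>t\<bar>)" for s t :: real
  proof -
    have "exp (s * t) \<le> exp \<bar>s * t\<bar>" "exp (- (s * t)) \<le> exp \<bar>s * t\<bar>" by simp_all
    then show ?thesis unfolding abs_mult by linarith
  qed
  have "weight c x \<le> (2 * exp (\<bar>fst c\<bar> * \<bar>fst x\<bar>)) * (2 * exp (\<bar>snd c\<bar> * \<bar>snd x\<bar>))"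
    unfolding weight_def by (intro mult_mono[OF * *] mult_nonneg_nonneg add_nonneg_nonneg exp_ge_zero) simp
  also have "\<dots> = 4 * exp (\<bar>fst c\<bar> * \<bar>fst x\<bar> + \<bar>snd c\<bar> * \<bar>snd x\<bar>)"
    by (simp add: exp_add)
  also have "\<dots> \<le> 4 * exp ((\<bar>fst c\<bar> + \<bar>snd c\<bar>) * norm1 x)"
    by (simp add: norm1_def algebra_simps)
  finally have "weight c x ^ n \<le> (4 * exp ((\<bar>fst c\<bar> + \<bar>snd c\<bar>) * norm1 x)) ^ n"
    by (intro power_mono) simp_all
  then show ?thesis
    by (simp add: power_mult_distrib mult.assoc flip: exp_of_nat_mult)
qed

lemma tame_integrable_weight:
  assumes "tame F"
  shows "integrable lborel (\<lambda>x. cmod (strip F y x) * weight c x ^ n)"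
proof (rule Bochner_Integration.integrable_bound)
  note [measurable] = measurable_strip[OF tame_entire2[OF assms]]
  let ?m = "real n * (\<bar>fst c\<bar> + \<bar>snd c\<bar>)"
  show "integrable lborel (\<lambda>x. 4 ^ n * (exp (?m * norm1 x) * cmod (strip F y x)))"
    by (intro integrable_mult_right tame_integrable_exp assms)
  show "(\<lambda>x. cmod (strip F y x) * weight c x ^ n) \<in> borel_measurable lborel"
    by measurable
  show "AE x in lborel. norm (cmod (strip F y x) * weight c x ^ n) \<le> norm (4 ^ n * (exp (?m * norm1 x) * cmod (strip F y x)))"
  proof (rule AE_I2)
    fix x
    show "norm (cmod (strip F y x) * weight c x ^ n) \<le> norm (4 ^ n * (exp (?m * norm1 x) * cmod (strip F y x)))"
      using mult_right_mono[OF weight_power_le[of c x n] norm_ge_zero[of "strip F y x"]]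
      by (simp add: abs_mult mult_ac)
  qed
qed

lemma tame_square_integrable_weight:
  assumes "tame F"
  shows "square_integrable (\<lambda>x. of_real (weight c x) * strip F y x)"
  unfolding square_integrable_def
proof
  note [measurable] = measurable_strip[OF tame_entire2[OF assms]]
  show 1: "(\<lambda>x. of_real (weight c x) * strip F y x) \<in> borel_measurable borel"
    by measurable
  let ?m = "real 2 * (\<bar>fst c\<bar> + \<bar>snd c\<bar>)"
  show "integrable lborel (\<lambda>x. (cmod (of_real (weight c x) * strip F y x))\<^sup>2)"
  proof (rule Bochner_Integration.integrable_bound)
    show "integrable lborel (\<lambda>x. 4 ^ 2 * ((cmod (strip F y x))\<^sup>2 * exp (?m * norm1 x)))"
      by (intro integrable_mult_right tame_integrable_sq assms)
    show "(\<lambda>x. (cmod (of_real (weight c x) * strip F y x))\<^sup>2) \<in> borel_measurable lborel"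
      by measurable
    show "AE x in lborel. norm ((cmod (of_real (weight c x) * strip F y x))\<^sup>2) \<le> norm (4 ^ 2 * ((cmod (strip F y x))\<^sup>2 * exp (?m * norm1 x)))"
    proof (rule AE_I2)
      fix x
      show "norm ((cmod (of_real (weight c x) * strip F y x))\<^sup>2) \<le> norm (4 ^ 2 * ((cmod (strip F y x))\<^sup>2 * exp (?m * norm1 x)))"
        using mult_right_mono[OF weight_power_le[of c x 2], of "(cmod (strip F y x))\<^sup>2"]
        by (simp add: norm_mult power_mult_distrib mult_ac)
    qed
  qed
qed

text \<open>S(e^{dP}) lifted to entire extensions. The four sign combinations are grouped and the
  signs written as \<open>- (- q)\<close> so that \<open>tame_add\<close> and
  \<open>tame_shift\<close> apply literally.\<close>

definition cosh_shift :: "real \<times> real \<Rightarrow> (complex \<times> complex \<Rightarrow> complex) \<Rightarrow> complex \<times> complex \<Rightarrow> complex" where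
  "cosh_shift d F = (\<lambda>z. let p = \<i> * of_real (fst d / (2 * pi)); q = \<i> * of_real (snd d / (2 * pi)) in
     (F (fst z - p, snd z - q) + F (fst z - p, snd z - (- q))) +
     (F (fst z - (- p), snd z - q) + F (fst z - (- p), snd z - (- q))))"

lemma tame_cosh_shift: "tame F \<Longrightarrow> tame (cosh_shift d F)"
  unfolding cosh_shift_def Let_def by (intro tame_add tame_shift)

lemma strip_cosh_shift:
  "strip (cosh_shift d F) 0 x =
    (let p = fst d / (2 * pi); q = snd d / (2 * pi) in
     (strip F (- p, - q) x + strip F (- p, q) x) + (strip F (p, - q) x + strip F (p, q) x))"
proof -
  have "Complex s 0 - \<i> * of_real t = Complex s (- t)" "Complex s 0 + \<i> * of_real t = Complex s t" for s t
    by (simp_all add: complex_eq_iff)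
  then show ?thesis
    by (simp only: cosh_shift_def strip_def Let_def fst_conv snd_conv fst_zero snd_zero diff_minus_eq_add)
qed

lemma S_expP_eq:
  assumes F: "entire2 F" and ext: "extends F a"
  shows "S_expP d a = strip (cosh_shift d F) 0"
proof -
  define q where "q = \<i> * complex_of_real (snd d / (2 * pi))"
  have a: "entire_ext a = F" by (rule entire_ext_eq[OF F ext])
  \<comment> \<open>The outer operators act through the entire extension of the intermediate
    function \<open>b\<close>, so that extension has to be identified first. The idle
    \<open>1 *\<close> and \<open>+ 0\<close> below match \<open>entire2_affine\<close>.\<close>
  define b where "b = (\<lambda>x. exp_P2 (snd d) a x + exp_P2 (- snd d) a x)"
  have b: "entire_ext b = (\<lambda>z. F (1 * fst z + 0, 1 * snd z + - q) + F (1 * fst z + 0, 1 * snd z + q))"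
  proof (rule entire_ext_eq)
    show "entire2 (\<lambda>z. F (1 * fst z + 0, 1 * snd z + - q) + F (1 * fst z + 0, 1 * snd z + q))"
      by (intro entire2_add entire2_affine F)
  qed (simp add: extends_def b_def exp_P2_def a q_def)
  have "S_expP d a = (\<lambda>x. exp_P1 (fst d) b x + exp_P1 (- fst d) b x)"
    by (simp add: S_expP_def op_add_def b_def)
  also have "\<dots> = strip (cosh_shift d F) 0"
    by (simp add: fun_eq_iff exp_P1_def b strip_def cosh_shift_def Let_def q_def flip: complex_of_real_def)
  finally show ?thesis .
qed

abbreviation (input) SS :: "real \<times> real \<Rightarrow> real \<times> real \<Rightarrow> plane_fun \<Rightarrow> plane_fun" where
  "SS c d a \<equiv> S_expQ c (S_expP d a)"

lemma S_expQ_eq: "S_expQ c f = (\<lambda>x. of_real (weight c x) * f x)"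
  by (simp add: fun_eq_iff S_expQ_def op_add_def exp_Q1_def exp_Q2_def weight_def algebra_simps)

lemma SS_eq:
  assumes "entire2 F" "extends F a"
  shows "SS c d a = (\<lambda>x. of_real (weight c x) * strip (cosh_shift d F) 0 x)"
  by (simp add: S_expQ_eq S_expP_eq[OF assms])

lemma extends_strip: "extends F a \<Longrightarrow> a = strip F 0"
  by (auto simp: extends_def strip_def complex_of_real_def)

lemma algAE:
  assumes "a \<in> algA"
  obtains F where "tame F" "extends F a" "a = strip F 0"
  using assms extends_strip unfolding algA_iff by blast

lemma algA_lin: "a \<in> algA \<Longrightarrow> b \<in> algA \<Longrightarrow> (\<lambda>x. a x + r * b x) \<in> algA"
  unfolding algA_iff
proof (elim exE conjE)
  fix F G assume "tame F" "extends F a" "tame G" "extends G b"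
  then show "\<exists>F. tame F \<and> extends F (\<lambda>x. a x + r * b x)"
    by (intro exI[of _ "\<lambda>z. F z + r * G z"]) (auto simp: extends_def intro: tame_add tame_cmult)
qed

text \<open>Linearity is not formal, because the imaginary shifts go through the definite
  description \<open>entire_ext\<close>; it holds on \<open>algA\<close> since a combination of
  extensions is the extension of the combination.\<close>

lemma SS_lin:
  assumes "a \<in> algA" "b \<in> algA"
  shows "SS c d (\<lambda>x. a x + r * b x) = (\<lambda>x. SS c d a x + r * SS c d b x)"
proof -
  obtain F G where F: "tame F" "extends F a" and G: "tame G" "extends G b"
    using assms by (auto simp: algA_iff)
  have "extends (\<lambda>z. F z + r * G z) (\<lambda>x. a x + r * b x)"
    using F G by (simp add: extends_def)
  moreover have "entire2 (\<lambda>z. F z + r * G z)"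
    by (intro entire2_add entire2_mult entire2_const tame_entire2 F G)
  ultimately show ?thesis
    by (simp add: SS_eq[of _ "\<lambda>x. a x + r * b x"] SS_eq[OF tame_entire2 F(2)] SS_eq[OF tame_entire2 G(2)] F G
        strip_cosh_shift Let_def) (simp add: strip_def algebra_simps)
qed

lemma SS_square_integrable:
  assumes "a \<in> algA"
  shows "square_integrable (SS c d a)"
proof -
  obtain F where F: "tame F" "extends F a"
    using assms by (auto simp: algA_iff)
  show ?thesis
    unfolding SS_eq[OF tame_entire2[OF F(1)] F(2)]
    by (intro tame_square_integrable_weight tame_cosh_shift F)
qed

section \<open>Real translations and the growth of the norm under them\<close>

definition translate :: "real \<times> real \<Rightarrow> plane_fun \<Rightarrow> plane_fun" where
  "translate u a = (\<lambda>x. a (x - u))"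

lemma extends_translate:
  assumes "extends F a"
  shows "extends (\<lambda>z. F (fst z - of_real (fst u), snd z - of_real (snd u))) (translate u a)"
proof -
  have "(x1, x2) - u = (x1 - fst u, x2 - snd u)" for x1 x2
    by (simp add: prod_eq_iff)
  then show ?thesis
    using assms by (simp add: extends_def translate_def flip: of_real_diff)
qed

lemma translate_algA: "a \<in> algA \<Longrightarrow> translate u a \<in> algA"
  unfolding algA_iff by (elim exE conjE) (intro exI conjI, erule tame_shift, erule extends_translate)

text \<open>Imaginary shifts commute with real translations, whereas the multiplication operator
  does not: the weight stays at \<open>x\<close> while the function moves to
  \<open>x - u\<close>.\<close>

lemma SS_translate:
  assumes "entire2 F" "extends F a"
  shows "SS c d (translate u a) = (\<lambda>x. of_real (weight c x) * strip (cosh_shift d F) 0 (x - u))"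
proof -
  define G where "G = (\<lambda>z. F (fst z - of_real (fst u), snd z - of_real (snd u)))"
  have G: "entire2 G"
    unfolding G_def using entire2_affine[OF assms(1), of 1 "- of_real (fst u)" 1 "- of_real (snd u)"] by simp
  have "strip G y x = strip F y (x - u)" for x y
  proof -
    have "Complex s t - of_real r = Complex (s - r) t" for s t r
      by (simp add: complex_eq_iff)
    then show ?thesis by (simp add: G_def strip_def)
  qed
  then show ?thesis
    using SS_eq[OF G, of "translate u a" c d] extends_translate[OF assms(2), of u]
    by (simp add: G_def[symmetric] strip_cosh_shift)
qed

text \<open>By submultiplicativity the weight at \<open>x\<close> costs at most
  \<open>weight c u\<close> times the weight at \<open>x - u\<close>, and the rest is translation
  invariance of Lebesgue measure.\<close>

lemma norm_SS_translate:
  assumes "a \<in> algA"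
  shows "norm_L2 (SS c d (translate u a)) \<le> weight c u * norm_L2 (SS c d a)"
proof -
  obtain F where F: "tame F" "extends F a"
    using assms by (auto simp: algA_iff)
  note SS = SS_eq[OF tame_entire2[OF F(1)] F(2)] and SSt = SS_translate[OF tame_entire2[OF F(1)] F(2)]
  define g where "g x = (cmod (SS c d a x))\<^sup>2" for x
  have ig: "integrable lborel g"
    using SS_square_integrable[OF assms, of c d] unfolding square_integrable_def g_def by blast
  then have [measurable]: "g \<in> borel_measurable borel" using borel_measurable_integrable by simp
  have "(norm_L2 (SS c d (translate u a)))\<^sup>2 \<le> (LINT x|lborel. (weight c u)\<^sup>2 * g (x - u))"
    unfolding norm_L2_power2
  proof (rule integral_mono)
    show "integrable lborel (\<lambda>x. (cmod (SS c d (translate u a) x))\<^sup>2)"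
      using SS_square_integrable[OF translate_algA[OF assms], of c d u] unfolding square_integrable_def by blast
    show "integrable lborel (\<lambda>x. (weight c u)\<^sup>2 * g (x - u))"
      by (intro integrable_mult_right integrable_translate ig)
    fix x
    have "(weight c x)\<^sup>2 \<le> (weight c u * weight c (x - u))\<^sup>2"
      by (intro power_mono weight_le_diff) simp
    from mult_right_mono[OF this, of "(cmod (strip (cosh_shift d F) 0 (x - u)))\<^sup>2"]
    show "(cmod (SS c d (translate u a) x))\<^sup>2 \<le> (weight c u)\<^sup>2 * g (x - u)"
      unfolding g_def SS SSt by (simp add: norm_mult power_mult_distrib mult_ac)
  qed
  also have "\<dots> = (weight c u)\<^sup>2 * (LINT x|lborel. g (x - u))"
    by simp
  also have "(LINT x|lborel. g (x - u)) = (LINT x|lborel. g x)"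
    by (rule integral_translate) measurable
  also have "(LINT x|lborel. g x) = (norm_L2 (SS c d a))\<^sup>2"
    unfolding norm_L2_power2 g_def ..
  finally have "(norm_L2 (SS c d (translate u a)))\<^sup>2 \<le> (weight c u * norm_L2 (SS c d a))\<^sup>2"
    by (simp add: power_mult_distrib)
  then show ?thesis
    by (rule power2_le_imp_le) simp
qed

section \<open>Convolution integrals and the exchange of their factors\<close>

lemma tame_prod_bound:
  assumes "tame F" "tame G"
  shows "\<exists>M. \<forall>s. norm1 s \<le> r \<longrightarrow>
     (\<integral>\<^sup>+u. ennreal (cmod (strip G s u * strip F (y - s) (x - u))) \<partial>lborel) \<le> ennreal M"
proof -
  note [measurable] = measurable_strip[OF tame_entire2[OF assms(1)]] measurable_strip[OF tame_entire2[OF assms(2)]]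
  \<comment> \<open>The imaginary parts \<open>s\<close> and \<open>y - s\<close> of the two factors
    add up to \<open>y\<close>, so \<open>F\<close> has to be controlled up to radius
    \<open>norm1 y + r\<close>.\<close>
  obtain M where "0 \<le> M" and M: "\<And>s. norm1 s \<le> norm1 y + r \<Longrightarrow>
     (\<integral>\<^sup>+x. ennreal ((cmod (strip F s x))\<^sup>2 * exp (0 * norm1 x)) \<partial>lborel) \<le> ennreal M"
    using tameE[OF assms(1), where r = "norm1 y + r" and m = 0] by blast
  obtain N where "0 \<le> N" and N: "\<And>s. norm1 s \<le> r \<Longrightarrow>
     (\<integral>\<^sup>+x. ennreal ((cmod (strip G s x))\<^sup>2 * exp (0 * norm1 x)) \<partial>lborel) \<le> ennreal N"
    using tameE[OF assms(2), where r = r and m = 0] by blast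
  show ?thesis
  proof (intro exI[of _ "N + M"] allI impI)
    fix s assume s: "norm1 s \<le> r"
    have "(\<integral>\<^sup>+u. ennreal (cmod (strip G s u * strip F (y - s) (x - u))) \<partial>lborel)
       \<le> (\<integral>\<^sup>+u. ennreal ((cmod (strip G s u))\<^sup>2) + ennreal ((cmod (strip F (y - s) (x - u)))\<^sup>2) \<partial>lborel)"
    proof (rule nn_integral_mono)
      fix u
      have "cmod (strip G s u * strip F (y - s) (x - u)) \<le> (cmod (strip G s u))\<^sup>2 + (cmod (strip F (y - s) (x - u)))\<^sup>2"
        unfolding norm_mult by (rule mult_le_sum_squares) simp_all
      then have "ennreal (cmod (strip G s u * strip F (y - s) (x - u)))
         \<le> ennreal ((cmod (strip G s u))\<^sup>2 + (cmod (strip F (y - s) (x - u)))\<^sup>2)"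
        by (rule ennreal_leI)
      also have "\<dots> = ennreal ((cmod (strip G s u))\<^sup>2) + ennreal ((cmod (strip F (y - s) (x - u)))\<^sup>2)"
        by (rule ennreal_plus) simp_all
      finally show "ennreal (cmod (strip G s u * strip F (y - s) (x - u)))
         \<le> ennreal ((cmod (strip G s u))\<^sup>2) + ennreal ((cmod (strip F (y - s) (x - u)))\<^sup>2)" .
    qed
    also have "\<dots> = (\<integral>\<^sup>+u. ennreal ((cmod (strip G s u))\<^sup>2) \<partial>lborel)
        + (\<integral>\<^sup>+u. ennreal ((cmod (strip F (y - s) (x - u)))\<^sup>2) \<partial>lborel)"
      by (rule nn_integral_add; measurable)
    also have "(\<integral>\<^sup>+u. ennreal ((cmod (strip F (y - s) (x - u)))\<^sup>2) \<partial>lborel)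
        = (\<integral>\<^sup>+u. ennreal ((cmod (strip F (y - s) u))\<^sup>2) \<partial>lborel)"
      by (rule nn_integral_reflect[of "\<lambda>u. ennreal ((cmod (strip F (y - s) u))\<^sup>2)"]) measurable
    also have "(\<integral>\<^sup>+u. ennreal ((cmod (strip G s u))\<^sup>2) \<partial>lborel)
        + (\<integral>\<^sup>+u. ennreal ((cmod (strip F (y - s) u))\<^sup>2) \<partial>lborel) \<le> ennreal N + ennreal M"
      using N[OF s] M[of "y - s"] norm1_diff[of y s] s by (intro add_mono) simp_all
    also have "\<dots> = ennreal (N + M)" using \<open>0 \<le> M\<close> \<open>0 \<le> N\<close> by simp
    finally show "(\<integral>\<^sup>+u. ennreal (cmod (strip G s u * strip F (y - s) (x - u))) \<partial>lborel) \<le> ennreal (N + M)" .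
  qed
qed

lemma tame_prod_integrable:
  assumes "tame F" "tame G"
  shows "integrable lborel (\<lambda>u. strip G s u * strip F y (x - u))"
proof (rule integrableI_bounded)
  note [measurable] = measurable_strip[OF tame_entire2[OF assms(1)]] measurable_strip[OF tame_entire2[OF assms(2)]]
  show "(\<lambda>u. strip G s u * strip F y (x - u)) \<in> borel_measurable lborel" by measurable
  \<comment> \<open>The preceding bound puts \<open>F\<close> on the slice \<open>y - s\<close>;
    taking it at \<open>y + s\<close> brings \<open>F\<close> back to \<open>y\<close>.\<close>
  obtain M where "\<forall>s'. norm1 s' \<le> norm1 s \<longrightarrow>
     (\<integral>\<^sup>+u. ennreal (cmod (strip G s' u * strip F ((y + s) - s') (x - u))) \<partial>lborel) \<le> ennreal M"
    using tame_prod_bound[OF assms] by blast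
  then have "(\<integral>\<^sup>+u. ennreal (cmod (strip G s u * strip F ((y + s) - s) (x - u))) \<partial>lborel) \<le> ennreal M"
    by blast
  also have "ennreal M < \<infinity>" by simp
  finally show "(\<integral>\<^sup>+u. ennreal (cmod (strip G s u * strip F y (x - u))) \<partial>lborel) < \<infinity>" by simp
qed

text \<open>For the entire integrand G(z) F(x + iy - z) the slice at height 0 carries the shift
  \<open>y\<close> on \<open>F\<close>, and the slice at height \<open>y\<close> carries it on
  \<open>G\<close>. Their integrals agree by the contour shift, and the reflection of
  \<open>u\<close> about \<open>x\<close> exchanges the roles of the real arguments.\<close>

lemma convolution_strip_commute:
  assumes F: "tame F" and G: "tame G"
  shows "(LINT u|lborel. strip F 0 u * strip G y (x - u)) = (LINT u|lborel. strip G 0 u * strip F y (x - u))"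
proof -
  note [measurable] = measurable_strip[OF tame_entire2[OF F]] measurable_strip[OF tame_entire2[OF G]]
  define K where "K = (\<lambda>z. G z * F (-1 * fst z + Complex (fst x) (fst y), -1 * snd z + Complex (snd x) (snd y)))"
  have K: "entire2 K"
    unfolding K_def by (intro entire2_mult entire2_affine tame_entire2 F G)
  have strip: "strip K s u = strip G s u * strip F (y - s) (x - u)" for s u
  proof -
    have "-1 * Complex p q + Complex p' q' = Complex (p' - p) (q' - q)" for p q p' q'
      by (simp add: complex_eq_iff)
    then show ?thesis by (simp only: K_def strip_def fst_conv snd_conv fst_diff snd_diff)
  qed
  have "(LINT u|lborel. strip K 0 u) = (LINT u|lborel. strip K y u)"
    by (rule contour_shift_plane[OF K]) (unfold strip, rule tame_prod_bound[OF F G])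
  then have "(LINT u|lborel. strip G 0 u * strip F y (x - u)) = (LINT u|lborel. strip G y u * strip F 0 (x - u))"
    by (simp add: strip)
  also have "\<dots> = (LINT u|lborel. (\<lambda>u. strip F 0 u * strip G y (x - u)) (x - u))"
    by (simp add: mult.commute)
  also have "\<dots> = (LINT u|lborel. strip F 0 u * strip G y (x - u))"
    by (rule integral_reflect) measurable
  finally show ?thesis ..
qed

lemma convolution_cosh_shift_commute:
  assumes F: "tame F" and G: "tame G"
  shows "(LINT u|lborel. strip F 0 u * strip (cosh_shift d G) 0 (x - u))
       = (LINT u|lborel. strip G 0 u * strip (cosh_shift d F) 0 (x - u))"
  unfolding strip_cosh_shift Let_def distrib_left
  by (simp add: tame_prod_integrable F G convolution_strip_commute[OF F G])

text \<open>Absolute integrability in four real variables, for Fubini. The weight at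
  \<open>x\<close> is split into weights at \<open>u\<close> and \<open>x - u\<close>: the first is
  absorbed by the decay of \<open>G\<close>, the second by that of \<open>B\<close>, while
  \<open>f\<close> is merely square integrable and enters through its square.\<close>

lemma pairing_integrable:
  assumes f: "square_integrable f" and B: "tame B" and G: "tame G"
  shows "integrable lborel (\<lambda>(u, x). strip G 0 u * (cnj (f x) * (of_real (weight c x) * strip B 0 (x - u))))"
proof (rule Bochner_Integration.integrable_bound)
  have [measurable]: "f \<in> borel_measurable borel"
    using f by (simp add: square_integrable_def)
  note [measurable] = measurable_strip[OF tame_entire2[OF B]] measurable_strip[OF tame_entire2[OF G]]
  define g where "g x = (cmod (of_real (weight c x) * strip B 0 x))\<^sup>2" for x
  have g: "integrable lborel g"
    using tame_square_integrable_weight[OF B, of c 0] unfolding square_integrable_def g_def by blast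
  have 1: "integrable lborel (\<lambda>x. (cmod (f x))\<^sup>2)"
    using f by (simp add: square_integrable_def)
  have 2: "integrable lborel (\<lambda>u. cmod (strip G 0 u))"
    using tame_integrable[OF G] by (rule integrable_norm)
  show "integrable lborel (\<lambda>p. cmod (strip G 0 (fst p)) * (cmod (f (snd p)))\<^sup>2 +
     (case p of (u, x) \<Rightarrow> (cmod (strip G 0 u) * weight c u ^ 2) * g (x - u)))"
    by (intro Bochner_Integration.integrable_add integrable_lborel_product[OF 2 1]
        integrable_convolution_kernel[OF tame_integrable_weight[OF G] g])
  show "(\<lambda>(u, x). strip G 0 u * (cnj (f x) * (of_real (weight c x) * strip B 0 (x - u)))) \<in> borel_measurable lborel"
    unfolding split_def by measurable
  show "AE p in lborel. norm (case p of (u, x) \<Rightarrow> strip G 0 u * (cnj (f x) * (of_real (weight c x) * strip B 0 (x - u))))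
    \<le> norm (cmod (strip G 0 (fst p)) * (cmod (f (snd p)))\<^sup>2 +
     (case p of (u, x) \<Rightarrow> (cmod (strip G 0 u) * weight c u ^ 2) * g (x - u)))"
  proof (rule AE_I2)
    fix p :: "(real \<times> real) \<times> (real \<times> real)"
    obtain u x where p: "p = (u, x)" by (cases p)
    let ?B = "cmod (strip B 0 (x - u))"
    have "(weight c x * ?B)\<^sup>2 \<le> ((weight c u * weight c (x - u)) * ?B)\<^sup>2"
      by (intro power_mono mult_right_mono weight_le_diff) simp_all
    then have 3: "(weight c x * ?B)\<^sup>2 \<le> weight c u ^ 2 * g (x - u)"
      by (simp add: g_def norm_mult power_mult_distrib mult_ac)
    have "cmod (f x) * (weight c x * ?B) \<le> (cmod (f x))\<^sup>2 + (weight c x * ?B)\<^sup>2"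
      by (intro mult_le_sum_squares) simp_all
    also have "\<dots> \<le> (cmod (f x))\<^sup>2 + weight c u ^ 2 * g (x - u)"
      using 3 by simp
    finally have "cmod (strip G 0 u) * (cmod (f x) * (weight c x * ?B))
        \<le> cmod (strip G 0 u) * ((cmod (f x))\<^sup>2 + weight c u ^ 2 * g (x - u))"
      by (rule mult_left_mono) simp
    then show "norm (case p of (u, x) \<Rightarrow> strip G 0 u * (cnj (f x) * (of_real (weight c x) * strip B 0 (x - u))))
    \<le> norm (cmod (strip G 0 (fst p)) * (cmod (f (snd p)))\<^sup>2 +
     (case p of (u, x) \<Rightarrow> (cmod (strip G 0 u) * weight c u ^ 2) * g (x - u)))"
      by (simp add: p norm_mult distrib_left mult.assoc)
  qed
qed

text \<open>After Fubini the dependence on \<open>a\<close> and \<open>G\<close> is confined to an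
  inner convolution that is symmetric by \<open>convolution_cosh_shift_commute\<close>. The
  operators are never applied to a convolution.\<close>

lemma pairing_eq:
  assumes f: "square_integrable f" and F: "tame F" "extends F a" and G: "tame G"
  shows "integrable lborel (\<lambda>u. strip G 0 u * l2_inner f (SS c d (translate u a)))"
    and "(LINT u|lborel. strip G 0 u * l2_inner f (SS c d (translate u a)))
       = (LINT x|lborel. cnj (f x) * of_real (weight c x) *
            (LINT u|lborel. strip G 0 u * strip (cosh_shift d F) 0 (x - u)))"
proof -
  let ?B = "strip (cosh_shift d F) 0"
  let ?\<Phi> = "\<lambda>u x. strip G 0 u * (cnj (f x) * (of_real (weight c x) * ?B (x - u)))"
  have int: "integrable (lborel \<Otimes>\<^sub>M lborel) (\<lambda>(u, x). ?\<Phi> u x)"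
    unfolding lborel_prod by (rule pairing_integrable[OF f tame_cosh_shift[OF F(1)] G])
  have eq: "strip G 0 u * l2_inner f (SS c d (translate u a)) = (LINT x|lborel. ?\<Phi> u x)" for u
    unfolding l2_inner_def SS_translate[OF tame_entire2[OF F(1)] F(2)]
    by (rule integral_mult_right_zero[symmetric])
  show "integrable lborel (\<lambda>u. strip G 0 u * l2_inner f (SS c d (translate u a)))"
    unfolding eq by (rule lborel_pair.integrable_fst[OF int])
  have "(LINT u|lborel. strip G 0 u * l2_inner f (SS c d (translate u a)))
      = (LINT u|lborel. LINT x|lborel. ?\<Phi> u x)"
    by (simp only: eq)
  also have "\<dots> = (LINT x|lborel. LINT u|lborel. ?\<Phi> u x)"
    by (rule lborel_pair.Fubini_integral[OF int, symmetric])
  also have "\<dots> = (LINT x|lborel. LINT u|lborel. (cnj (f x) * of_real (weight c x)) * (strip G 0 u * ?B (x - u)))"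
    by (simp only: mult_ac)
  also have "\<dots> = (LINT x|lborel. cnj (f x) * of_real (weight c x) * (LINT u|lborel. strip G 0 u * ?B (x - u)))"
    by (simp only: integral_mult_right_zero)
  finally show "(LINT u|lborel. strip G 0 u * l2_inner f (SS c d (translate u a)))
       = (LINT x|lborel. cnj (f x) * of_real (weight c x) * (LINT u|lborel. strip G 0 u * ?B (x - u)))" .
qed

section \<open>Smearing a covariant functional over translations\<close>

lemma tame_integrable_exp_linear:
  assumes "tame F"
  shows "integrable lborel (\<lambda>u. strip F y u * of_real (exp (p * fst u + q * snd u)))"
proof (rule Bochner_Integration.integrable_bound)
  note [measurable] = measurable_strip[OF tame_entire2[OF assms]]
  show "integrable lborel (\<lambda>u. exp ((\<bar>p\<bar> + \<bar>q\<bar>) * norm1 u) * cmod (strip F y u))"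
    by (rule tame_integrable_exp[OF assms])
  show "(\<lambda>u. strip F y u * of_real (exp (p * fst u + q * snd u))) \<in> borel_measurable lborel"
    by measurable
  show "AE u in lborel. norm (strip F y u * of_real (exp (p * fst u + q * snd u)))
     \<le> norm (exp ((\<bar>p\<bar> + \<bar>q\<bar>) * norm1 u) * cmod (strip F y u))"
  proof (rule AE_I2)
    fix u
    have "p * fst u + q * snd u \<le> \<bar>p\<bar> * \<bar>fst u\<bar> + \<bar>q\<bar> * \<bar>snd u\<bar>"
      using abs_ge_self[of "p * fst u"] abs_ge_self[of "q * snd u"] by (simp add: abs_mult)
    also have "\<dots> \<le> (\<bar>p\<bar> + \<bar>q\<bar>) * norm1 u"
      by (simp add: norm1_def algebra_simps)
    finally show "norm (strip F y u * of_real (exp (p * fst u + q * snd u)))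
       \<le> norm (exp ((\<bar>p\<bar> + \<bar>q\<bar>) * norm1 u) * cmod (strip F y u))"
      by (simp add: norm_mult mult.commute mult_left_mono)
  qed
qed

text \<open>The two-sided Laplace transform of \<open>a\<close> at real arguments. At
  \<open>2 * pi\<close> times \<open>\<alpha>k\<close> and \<open>\<beta>k\<close> it is
  \<open>hk\<close>, and it is the number that covariance produces when translates are averaged
  against \<open>a\<close>.\<close>

definition laplace :: "real \<Rightarrow> real \<Rightarrow> plane_fun \<Rightarrow> complex" where
  "laplace p q a = (LINT u|lborel. a u * of_real (exp (p * fst u + q * snd u)))"

text \<open>Were \<open>l2_inner f\<close> composed with \<open>SS c d\<close> equal to
  \<open>h\<close>, covariance would pull \<open>h a\<close> out of the integral exactly. The
  pointwise error at \<open>u\<close> is \<epsilon> times the norm of the translate, hence at most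
  \<open>weight c u\<close> times a constant, and the decay of \<open>G\<close> absorbs the
  weight.\<close>

lemma covariant_approx:
  assumes cov: "\<And>u a. a \<in> algA \<Longrightarrow> h (translate u a) = of_real (exp (p * fst u + q * snd u)) * h a"
    and v: "\<And>b. b \<in> algA \<Longrightarrow> cmod (l2_inner f (SS c d b) - h b) \<le> \<epsilon> * norm_L2 (SS c d b)"
    and f: "square_integrable f" and \<epsilon>: "0 \<le> \<epsilon>"
    and F: "tame F" "extends F a" and G: "tame G"
  shows "cmod ((LINT u|lborel. strip G 0 u * l2_inner f (SS c d (translate u a))) - laplace p q (strip G 0) * h a)
     \<le> \<epsilon> * (norm_L2 (SS c d a) * (LINT u|lborel. cmod (strip G 0 u) * weight c u))"
proof -
  have a: "a \<in> algA" using F by (auto simp: algA_iff)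
  have int1: "integrable lborel (\<lambda>u. strip G 0 u * l2_inner f (SS c d (translate u a)))"
    by (rule pairing_eq(1)[OF f F G])
  have int2: "integrable lborel (\<lambda>u. strip G 0 u * of_real (exp (p * fst u + q * snd u)) * h a)"
    by (intro integrable_mult_left tame_integrable_exp_linear G)
  have "integrable lborel (\<lambda>u. cmod (strip G 0 u) * weight c u ^ 1)"
    by (rule tame_integrable_weight[OF G])
  then have int3: "integrable lborel (\<lambda>u. (\<epsilon> * norm_L2 (SS c d a)) * (cmod (strip G 0 u) * weight c u))"
    by (intro integrable_mult_right) simp
  define D where "D u = strip G 0 u * l2_inner f (SS c d (translate u a))
      - strip G 0 u * of_real (exp (p * fst u + q * snd u)) * h a" for u
  have D: "integrable lborel D"
    unfolding D_def by (rule Bochner_Integration.integrable_diff[OF int1 int2])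
  have D_le: "cmod (D u) \<le> (\<epsilon> * norm_L2 (SS c d a)) * (cmod (strip G 0 u) * weight c u)" for u
  proof -
    have "D u = strip G 0 u * (l2_inner f (SS c d (translate u a)) - h (translate u a))"
      unfolding D_def cov[OF a] by (simp only: right_diff_distrib mult.assoc)
    then have "cmod (D u) = cmod (strip G 0 u) * cmod (l2_inner f (SS c d (translate u a)) - h (translate u a))"
      by (simp only: norm_mult)
    also have "\<dots> \<le> cmod (strip G 0 u) * (\<epsilon> * norm_L2 (SS c d (translate u a)))"
      by (rule mult_left_mono[OF v[OF translate_algA[OF a]] norm_ge_zero])
    also have "\<dots> \<le> cmod (strip G 0 u) * (\<epsilon> * (weight c u * norm_L2 (SS c d a)))"
      by (rule mult_left_mono[OF mult_left_mono[OF norm_SS_translate[OF a] \<epsilon>] norm_ge_zero])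
    finally show ?thesis by (simp only: mult_ac)
  qed
  have "(LINT u|lborel. strip G 0 u * l2_inner f (SS c d (translate u a))) - laplace p q (strip G 0) * h a
     = (LINT u|lborel. D u)"
    unfolding D_def Bochner_Integration.integral_diff[OF int1 int2] laplace_def by simp
  also have "cmod \<dots> \<le> (LINT u|lborel. cmod (D u))"
    by (rule integral_norm_bound)
  also have "\<dots> \<le> (LINT u|lborel. (\<epsilon> * norm_L2 (SS c d a)) * (cmod (strip G 0 u) * weight c u))"
    by (rule integral_mono[OF integrable_norm[OF D] int3 D_le])
  also have "\<dots> = \<epsilon> * (norm_L2 (SS c d a) * (LINT u|lborel. cmod (strip G 0 u) * weight c u))"
    by (simp add: mult.assoc)
  finally show ?thesis .
qed

text \<open>A single number, the smeared pairing, is computed in two ways: averaging translates of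
  \<open>a\<close> against \<open>b\<close> gives nearly \<open>laplace p q b * h a\<close>, and
  averaging translates of \<open>b\<close> against \<open>a\<close> gives nearly the other
  side.\<close>

theorem covariant_functional_proportional:
  assumes h: "linear_functional h"
    and cov: "\<And>u a. a \<in> algA \<Longrightarrow> h (translate u a) = of_real (exp (p * fst u + q * snd u)) * h a"
    and bound: "\<And>a. a \<in> algA \<Longrightarrow> cmod (h a) \<le> C * norm_L2 (SS c d a)"
    and a: "a \<in> algA" and b: "b \<in> algA"
  shows "laplace p q b * h a = laplace p q a * h b"
proof -
  obtain F where F: "tame F" "extends F a" "a = strip F 0" using a by (rule algAE)
  obtain G where G: "tame G" "extends G b" "b = strip G 0" using b by (rule algAE)
  \<comment> \<open>Additivity needs \<open>r * b\<close> to lie in \<open>algA\<close>; it is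
    obtained as \<open>0 * b + r * b\<close>, and the zero function as
    \<open>b + (-1) * b\<close>.\<close>
  have lin: "h (\<lambda>x. a x + r * b x) = h a + r * h b" if "a \<in> algA" "b \<in> algA" for a b r
    using h that algA_lin[of "\<lambda>x. 0 * b x" b r] algA_lin[of b b "-1"]
    unfolding linear_functional_def by simp
  have ne: "algA \<noteq> {}" using a by blast
  \<comment> \<open>\<open>X\<close> and \<open>Y\<close> depend on \<open>a\<close> and
    \<open>b\<close> only, not on the approximating vector, which changes with \<epsilon>.\<close>
  define X where "X = norm_L2 (SS c d a) * (LINT u|lborel. cmod (strip G 0 u) * weight c u)"
  define Y where "Y = norm_L2 (SS c d b) * (LINT u|lborel. cmod (strip F 0 u) * weight c u)"
  define M where "M = Y + X"
  have "cmod (laplace p q b * h a - laplace p q a * h b) \<le> \<epsilon> * M" if \<epsilon>: "\<epsilon> > 0" for \<epsilon>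
  proof -
    obtain v where v: "v \<in> algA" and
      approx: "\<And>b. b \<in> algA \<Longrightarrow> cmod (l2_inner (SS c d v) (SS c d b) - h b) \<le> \<epsilon> * norm_L2 (SS c d b)"
      using approximate_riesz[of algA "SS c d" h C \<epsilon>, OF ne algA_lin SS_lin lin SS_square_integrable bound \<epsilon>]
      by blast
    note f = SS_square_integrable[OF v, of c d]
    let ?f = "SS c d v"
    let ?I = "LINT u|lborel. strip G 0 u * l2_inner ?f (SS c d (translate u a))"
    let ?J = "LINT u|lborel. strip F 0 u * l2_inner ?f (SS c d (translate u b))"
    have "?I = ?J"
      unfolding pairing_eq(2)[OF f F(1,2) G(1)] pairing_eq(2)[OF f G(1,2) F(1)]
        convolution_cosh_shift_commute[OF F(1) G(1)] ..
    note approx' = covariant_approx[where h = h and p = p and q = q and c = c and d = d, OF cov approx f less_imp_le[OF \<epsilon>]]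
    have A: "cmod (?J - laplace p q a * h b) \<le> \<epsilon> * Y"
      using approx'[OF _ _ G(1,2) F(1)] by (simp only: Y_def F(3)[symmetric])
    have B: "cmod (?I - laplace p q b * h a) \<le> \<epsilon> * X"
      using approx'[OF _ _ F(1,2) G(1)] by (simp only: X_def G(3)[symmetric])
    have "cmod (laplace p q b * h a - laplace p q a * h b)
        = cmod ((?J - laplace p q a * h b) - (?I - laplace p q b * h a))"
      using \<open>?I = ?J\<close> by simp
    also have "\<dots> \<le> cmod (?J - laplace p q a * h b) + cmod (?I - laplace p q b * h a)"
      by (rule norm_triangle_ineq4)
    also have "\<dots> \<le> \<epsilon> * Y + \<epsilon> * X"
      by (rule add_mono[OF A B])
    also have "\<dots> = \<epsilon> * M"
      by (simp only: M_def distrib_left)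
    finally show ?thesis .
  qed
  note * = this
  have "cmod (laplace p q b * h a - laplace p q a * h b) \<le> 0"
  proof (rule field_le_epsilon)
    fix e :: real assume "e > 0"
    have "0 \<le> X" "0 \<le> Y"
      unfolding X_def Y_def by (simp_all add: mult_nonneg_nonneg Bochner_Integration.integral_nonneg)
    then have M: "0 \<le> M" by (simp add: M_def)
    \<comment> \<open>The denominator \<open>M + 1\<close> covers the case
      \<open>M = 0\<close>.\<close>
    have "cmod (laplace p q b * h a - laplace p q a * h b) \<le> e / (M + 1) * M"
      by (rule *) (use M \<open>e > 0\<close> in simp)
    also have "\<dots> \<le> e" using M \<open>e > 0\<close> by (simp add: field_simps)
    finally show "cmod (laplace p q b * h a - laplace p q a * h b) \<le> 0 + e" by simp
  qed
  then show ?thesis by simp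
qed

section \<open>The Gaussian\<close>

lemma entire2_fst: "entire2 fst"
  unfolding entire2_def by (intro allI exI[of _ 1] exI[of _ 0]) (simp add: bounded_linear_imp_has_derivative bounded_linear_fst)

lemma entire2_snd: "entire2 snd"
  unfolding entire2_def by (intro allI exI[of _ 0] exI[of _ 1]) (simp add: bounded_linear_imp_has_derivative bounded_linear_snd)

lemma entire2_exp:
  assumes "entire2 F"
  shows "entire2 (\<lambda>z. exp (F z))"
  unfolding entire2_def
proof
  fix z
  obtain A B where 1: "(F has_derivative (\<lambda>w. A * fst w + B * snd w)) (at z)"
    using assms unfolding entire2_def by blast
  have 2: "(exp has_derivative (\<lambda>h. exp (F z) * h)) (at (F z))"
    using DERIV_exp[of "F z"] by (simp add: has_field_derivative_def)
  show "\<exists>A B. ((\<lambda>z. exp (F z)) has_derivative (\<lambda>w. A * fst w + B * snd w)) (at z)"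
    using has_derivative_compose[OF 1 2]
    by (intro exI[of _ "exp (F z) * A"] exI[of _ "exp (F z) * B"]) (simp add: algebra_simps)
qed

text \<open>In Weyl calculus \<open>2 * gauss\<close> is the symbol of the projection onto the
  oscillator ground state, the normalised multiple of \<open>exp (- pi * t^2)\<close>.\<close>

definition gauss :: plane_fun where
  "gauss x = of_real (exp (- (2 * pi * ((fst x)\<^sup>2 + (snd x)\<^sup>2))))"

definition gauss_ext :: "complex \<times> complex \<Rightarrow> complex" where
  "gauss_ext z = exp (- of_real (2 * pi) * (fst z * fst z + snd z * snd z))"

lemma entire2_gauss_ext: "entire2 gauss_ext"
proof -
  have "entire2 (\<lambda>z. exp (- of_real (2 * pi) * (fst z * fst z + snd z * snd z)))"
    by (intro entire2_exp entire2_mult entire2_add entire2_const entire2_fst entire2_snd)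
  then show ?thesis by (simp add: gauss_ext_def[abs_def])
qed

lemma cmod_strip_gauss_ext:
  "(cmod (strip gauss_ext y x))\<^sup>2
     = exp (4 * pi * ((fst y)\<^sup>2 + (snd y)\<^sup>2) - 4 * pi * ((fst x)\<^sup>2 + (snd x)\<^sup>2))"
proof -
  have "cmod (strip gauss_ext y x) = exp (2 * pi * ((fst y)\<^sup>2 + (snd y)\<^sup>2) - 2 * pi * ((fst x)\<^sup>2 + (snd x)\<^sup>2))"
    by (simp add: strip_def gauss_ext_def power2_eq_square algebra_simps)
  then show ?thesis by (simp add: algebra_simps flip: exp_double)
qed

lemma tame_gauss_ext: "tame gauss_ext"
proof (rule tameI[OF entire2_gauss_ext])
  fix m r :: real assume m: "0 \<le> m" and r: "0 \<le> r"
  define I where "I = (LINT x|lborel. exp (- norm1 x))"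
  show "\<exists>M. \<forall>y. norm1 y \<le> r \<longrightarrow>
     (\<integral>\<^sup>+x. ennreal ((cmod (strip gauss_ext y x))\<^sup>2 * exp (m * norm1 x)) \<partial>lborel) \<le> ennreal M"
  proof (intro exI[of _ "exp (8 * pi * r\<^sup>2 + 2 * (m + 1)\<^sup>2) * I"] allI impI)
    fix y assume y: "norm1 y \<le> r"
    have sq: "s\<^sup>2 \<le> r\<^sup>2" if "\<bar>s\<bar> \<le> r" for s
      using that r by (metis abs_le_square_iff abs_of_nonneg)
    have y2: "(fst y)\<^sup>2 + (snd y)\<^sup>2 \<le> 2 * r\<^sup>2"
    proof -
      have "\<bar>fst y\<bar> \<le> r" "\<bar>snd y\<bar> \<le> r"
        using y abs_ge_zero[of "fst y"] abs_ge_zero[of "snd y"] unfolding norm1_def by linarith+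
      from sq[OF this(1)] sq[OF this(2)] show ?thesis by simp
    qed
    \<comment> \<open>Using \<open>m + 1\<close> instead of \<open>m\<close> leaves the factor
      \<open>exp (- norm1 x)\<close> over, which is the integrable majorant.\<close>
    have x1: "(m + 1) * \<bar>t\<bar> \<le> 4 * pi * t\<^sup>2 + (m + 1)\<^sup>2" for t :: real
    proof -
      have "(m + 1) * \<bar>t\<bar> \<le> \<bar>t\<bar>\<^sup>2 + (m + 1)\<^sup>2"
        using m mult_le_sum_squares[of "\<bar>t\<bar>" "m + 1"] by (simp add: mult.commute)
      also have "\<bar>t\<bar>\<^sup>2 \<le> 4 * pi * t\<^sup>2"
        using mult_right_mono[of 1 "4 * pi" "t\<^sup>2"] pi_gt3 by simp
      finally show ?thesis by simp
    qed
    have "(\<integral>\<^sup>+x. ennreal ((cmod (strip gauss_ext y x))\<^sup>2 * exp (m * norm1 x)) \<partial>lborel)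
       \<le> (\<integral>\<^sup>+x. ennreal (exp (8 * pi * r\<^sup>2 + 2 * (m + 1)\<^sup>2) * exp (- norm1 x)) \<partial>lborel)"
    proof (intro nn_integral_mono ennreal_leI)
      fix x :: "real \<times> real"
      have "4 * pi * ((fst y)\<^sup>2 + (snd y)\<^sup>2) \<le> 4 * pi * (2 * r\<^sup>2)"
        by (rule mult_left_mono[OF y2]) simp
      then have "4 * pi * ((fst y)\<^sup>2 + (snd y)\<^sup>2) - 4 * pi * ((fst x)\<^sup>2 + (snd x)\<^sup>2) + m * norm1 x
         \<le> 8 * pi * r\<^sup>2 + 2 * (m + 1)\<^sup>2 - norm1 x"
        using x1[of "fst x"] x1[of "snd x"] by (simp add: norm1_def algebra_simps)
      then show "(cmod (strip gauss_ext y x))\<^sup>2 * exp (m * norm1 x)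
         \<le> exp (8 * pi * r\<^sup>2 + 2 * (m + 1)\<^sup>2) * exp (- norm1 x)"
        unfolding cmod_strip_gauss_ext by (simp flip: exp_add)
    qed
    also have "\<dots> = ennreal (exp (8 * pi * r\<^sup>2 + 2 * (m + 1)\<^sup>2) * I)"
      unfolding I_def using integrable_exp_minus_norm1
      by (subst nn_integral_eq_integral) simp_all
    finally show "(\<integral>\<^sup>+x. ennreal ((cmod (strip gauss_ext y x))\<^sup>2 * exp (m * norm1 x)) \<partial>lborel)
      \<le> ennreal (exp (8 * pi * r\<^sup>2 + 2 * (m + 1)\<^sup>2) * I)" .
  qed
qed

lemma extends_gauss: "extends gauss_ext gauss"
  by (simp add: extends_def gauss_ext_def gauss_def power2_eq_square flip: exp_of_real)

lemma gauss_algA: "gauss \<in> algA"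
  unfolding algA_iff using tame_gauss_ext extends_gauss by blast

lemma gauss_strip: "gauss = strip gauss_ext 0"
  by (rule extends_strip[OF extends_gauss])

section \<open>Gaussian Fourier integrals and the product of the Gaussian with itself\<close>

lemma fourier_gaussian:
  fixes A y :: real
  assumes A: "A > 0"
  shows "integrable lborel (\<lambda>v. of_real (exp (- (A * v\<^sup>2))) * exp (\<i> * of_real (y * v)))" (is "integrable _ ?f")
    and "(LINT v|lborel. of_real (exp (- (A * v\<^sup>2))) * exp (\<i> * of_real (y * v)))
       = of_real (sqrt (pi / A) * exp (- (y\<^sup>2 / (4 * A))))"
proof -
  \<comment> \<open>The rescaling \<open>x = s * v\<close> turns \<open>exp (- A * v^2)\<close> into
    the standard normal density up to the factor \<open>sqrt (2 * pi)\<close>, so the integral is a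
    value of its characteristic function.\<close>
  define s where "s = sqrt (2 * A)"
  have s: "s > 0" "s\<^sup>2 = 2 * A" using A by (simp_all add: s_def)
  define t where "t = y / s"
  define g where "g x = complex_of_real (std_normal_density x) * exp (\<i> * of_real (t * x))" for x
  have ig: "integrable lborel g"
  proof (rule Bochner_Integration.integrable_bound)
    show "integrable lborel std_normal_density" by simp
    show "g \<in> borel_measurable lborel"
      unfolding g_def
      by (simp add: measurable_lborel1) (intro borel_measurable_times borel_measurable_of_real borel_measurable_continuous_onI continuous_intros; simp)?
  qed (simp add: g_def norm_mult normal_density_nonneg)
  have "(LINT x|lborel. g x) = char std_normal_distribution t"
    unfolding char_def g_def
    by (subst integral_density) (simp_all add: normal_density_nonneg scaleR_conv_of_real)
  then have Ig: "(LINT x|lborel. g x) = of_real (exp (- (t\<^sup>2 / 2)))"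
    by (simp add: char_std_normal_distribution)
  have f: "?f v = of_real (sqrt (2 * pi)) * g (0 + s * v)" for v
  proof -
    have 1: "t * (s * v) = y * v" using s by (simp add: t_def)
    have 2: "- (s * v)\<^sup>2 / 2 = - (A * v\<^sup>2)" by (simp add: power_mult_distrib s)
    show ?thesis
      unfolding g_def std_normal_density_def add_0 1 2 by simp
  qed
  show "integrable lborel ?f"
    unfolding f using lborel_integrable_real_affine[OF ig, of s 0] s by (intro integrable_mult_right) simp
  have "(LINT v|lborel. ?f v) = of_real (sqrt (2 * pi)) * (LINT v|lborel. g (0 + s * v))"
    unfolding f by (rule integral_mult_right_zero)
  also have "(LINT v|lborel. g (0 + s * v)) = of_real (exp (- (t\<^sup>2 / 2)) / s)"
    using lborel_integral_real_affine[of s g 0] s Ig by (simp add: scaleR_conv_of_real field_simps)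
  also have "of_real (sqrt (2 * pi)) * of_real (exp (- (t\<^sup>2 / 2)) / s)
      = complex_of_real (sqrt (pi / A) * exp (- (y\<^sup>2 / (4 * A))))"
  proof -
    have "sqrt (2 * pi) / s = sqrt (pi / A)"
      unfolding s_def by (simp add: real_sqrt_divide[symmetric])
    moreover have "t\<^sup>2 / 2 = y\<^sup>2 / (4 * A)"
      by (simp add: t_def power_divide s)
    ultimately show ?thesis
      by (metis of_real_mult times_divide_eq_left times_divide_eq_right mult.commute)
  qed
  finally show "(LINT v|lborel. ?f v) = of_real (sqrt (pi / A) * exp (- (y\<^sup>2 / (4 * A))))" .
qed

text \<open>The product of the Gaussians centred at 0 and \<open>x\<close> is one Gaussian centred
  at \<open>x / 2\<close>; recentring there produces the phase
  \<open>2 * pi * x * y\<close>.\<close>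

lemma fourier_two_gaussians:
  fixes x y :: real
  defines "f \<equiv> \<lambda>u. of_real (exp (- (2 * pi * u\<^sup>2) - 2 * pi * (u - x)\<^sup>2)) * exp (\<i> * of_real (4 * pi * y * u))"
  shows "integrable lborel f"
    and "(LINT u|lborel. f u) = of_real (exp (- (pi * (x\<^sup>2 + y\<^sup>2))) / 2) * exp (\<i> * of_real (2 * pi * x * y))"
proof -
  let ?g = "\<lambda>v. complex_of_real (exp (- ((4 * pi) * v\<^sup>2))) * exp (\<i> * of_real ((4 * pi * y) * v))"
  let ?c = "complex_of_real (exp (- (pi * x\<^sup>2))) * exp (\<i> * of_real (2 * pi * x * y))"
  have shift: "f u = ?c * ?g (u - x / 2)" for u
  proof -
    have "- (2 * pi * u\<^sup>2) - 2 * pi * (u - x)\<^sup>2 = - (pi * x\<^sup>2) + - ((4 * pi) * (u - x / 2)\<^sup>2)"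
      by (simp add: power2_eq_square algebra_simps)
    then have 1: "exp (- (2 * pi * u\<^sup>2) - 2 * pi * (u - x)\<^sup>2) = exp (- (pi * x\<^sup>2)) * exp (- ((4 * pi) * (u - x / 2)\<^sup>2))"
      by (simp only: exp_add)
    have "4 * pi * y * u = 2 * pi * x * y + (4 * pi * y) * (u - x / 2)"
      by (simp add: algebra_simps)
    then have 2: "exp (\<i> * complex_of_real (4 * pi * y * u))
       = exp (\<i> * of_real (2 * pi * x * y)) * exp (\<i> * of_real ((4 * pi * y) * (u - x / 2)))"
      by (simp only: of_real_add distrib_left exp_add)
    show ?thesis unfolding f_def 1 2 by (simp only: of_real_mult mult_ac)
  qed
  have pos: "4 * pi > 0" by simp
  note g = fourier_gaussian[OF pos, of "4 * pi * y"]
  have mg: "?g \<in> borel_measurable borel"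
    using borel_measurable_integrable[OF g(1)] by simp
  show "integrable lborel f"
    using integrable_mult_right[OF integrable_translate[OF g(1), of "x / 2"], of ?c] by (simp only: shift[symmetric] fun_eq_iff eta_contract_eq)
  have "(LINT u|lborel. f u) = ?c * (LINT u|lborel. ?g (u - x / 2))"
    unfolding shift by (rule integral_mult_right_zero)
  also have "(LINT u|lborel. ?g (u - x / 2)) = (LINT u|lborel. ?g u)"
    by (rule integral_translate[OF mg])
  also have "\<dots> = of_real (sqrt (pi / (4 * pi)) * exp (- ((4 * pi * y)\<^sup>2 / (4 * (4 * pi)))))"
    by (rule g(2))
  also have "sqrt (pi / (4 * pi)) * exp (- ((4 * pi * y)\<^sup>2 / (4 * (4 * pi)))) = exp (- (pi * y\<^sup>2)) / 2"
  proof -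
    have "sqrt (pi / (4 * pi)) = 1 / 2" by (simp add: real_sqrt_divide)
    moreover have "(4 * pi * y)\<^sup>2 / (4 * (4 * pi)) = pi * y\<^sup>2" by (simp add: power2_eq_square)
    ultimately show ?thesis by simp
  qed
  also have "?c * of_real (exp (- (pi * y\<^sup>2)) / 2)
     = of_real (exp (- (pi * (x\<^sup>2 + y\<^sup>2))) / 2) * exp (\<i> * of_real (2 * pi * x * y))"
  proof -
    have "exp (- (pi * (x\<^sup>2 + y\<^sup>2))) / 2 = exp (- (pi * x\<^sup>2)) * (exp (- (pi * y\<^sup>2)) / 2)"
      by (simp add: distrib_left flip: exp_add)
    then show ?thesis by (simp only: of_real_mult mult_ac)
  qed
  finally show "(LINT u|lborel. f u) = of_real (exp (- (pi * (x\<^sup>2 + y\<^sup>2))) / 2) * exp (\<i> * of_real (2 * pi * x * y))" .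
qed

text \<open>The phase is affine in each integration variable separately, so both the inner and the
  outer plane integral factor into one-dimensional Gaussian Fourier integrals.\<close>

lemma alg_mult_gauss: "alg_mult gauss gauss = (\<lambda>x. 1 / 2 * gauss x)"
proof
  fix x :: "real \<times> real"
  define x1 x2 where "x1 = fst x" and "x2 = snd x"
  define e where "e r = exp (\<i> * complex_of_real r)" for r
  have e_add: "e (r + s) = e r * e s" for r s
    by (simp add: e_def distrib_left exp_add)
  have norm_e: "cmod (e r) = 1" for r by (simp add: e_def)
  define E where "E u v = gauss u * gauss v *
    e (4 * pi * ((x1 - fst u) * (x2 - snd v) - (x1 - fst v) * (x2 - snd u)))" for u v
  have gm [measurable]: "gauss \<in> borel_measurable borel"
    unfolding gauss_strip by (rule measurable_strip[OF entire2_gauss_ext])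
  have int: "integrable (lborel \<Otimes>\<^sub>M lborel) (\<lambda>(u, v). E u v)"
    unfolding lborel_prod
  proof (rule Bochner_Integration.integrable_bound)
    have "integrable lborel (\<lambda>u. cmod (gauss u))"
      unfolding gauss_strip by (rule integrable_norm[OF tame_integrable[OF tame_gauss_ext]])
    from integrable_lborel_product[OF this this]
    show "integrable lborel (\<lambda>p. cmod (gauss (fst p)) * cmod (gauss (snd p)))" .
    have "continuous_on UNIV (\<lambda>p :: (real \<times> real) \<times> (real \<times> real). e (4 * pi *
        ((x1 - fst (fst p)) * (x2 - snd (snd p)) - (x1 - fst (snd p)) * (x2 - snd (fst p)))))"
      unfolding e_def by (intro continuous_intros)
    then have [measurable]: "(\<lambda>p :: (real \<times> real) \<times> (real \<times> real). e (4 * pi *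
        ((x1 - fst (fst p)) * (x2 - snd (snd p)) - (x1 - fst (snd p)) * (x2 - snd (fst p))))) \<in> borel_measurable borel"
      by (rule borel_measurable_continuous_onI)
    show "(\<lambda>(u, v). E u v) \<in> borel_measurable lborel"
      unfolding E_def split_def by measurable
    show "AE p in lborel. cmod (case p of (u, v) \<Rightarrow> E u v) \<le> norm (cmod (gauss (fst p)) * cmod (gauss (snd p)))"
      by (intro AE_I2) (simp add: E_def norm_mult norm_e split_def)
  qed
  let ?f = "\<lambda>x y u. complex_of_real (exp (- (2 * pi * u\<^sup>2) - 2 * pi * (u - x)\<^sup>2)) * exp (\<i> * of_real (4 * pi * y * u))"
  \<comment> \<open>For fixed \<open>u\<close> the frequencies in \<open>v\<close> are proportional
    to \<open>x2 - snd u\<close> and \<open>fst u - x1\<close>, so integrating out \<open>v\<close>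
    yields Gaussians in \<open>u\<close> centred at \<open>x1\<close> and \<open>x2\<close>, with a
    remaining phase linear in \<open>u\<close>.\<close>
  have inner: "(LINT v|lborel. E u v) = 1 / 2 * (?f x1 (- x2) (fst u) * ?f x2 x1 (snd u))" for u
  proof -
    let ?g = "\<lambda>y v. complex_of_real (exp (- ((2 * pi) * v\<^sup>2))) * exp (\<i> * of_real (y * v))"
    define k where "k = gauss u * e (4 * pi * (- x2) * fst u) * e (4 * pi * x1 * snd u)"
    have pos: "2 * pi > 0" by simp
    have E: "E u v = k * (?g (4 * pi * (x2 - snd u)) (fst v) * ?g (4 * pi * (fst u - x1)) (snd v))" for v
    proof -
      have "4 * pi * ((x1 - fst u) * (x2 - snd v) - (x1 - fst v) * (x2 - snd u))
        = (4 * pi * (- x2) * fst u + 4 * pi * x1 * snd u)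
          + (4 * pi * (x2 - snd u) * fst v + 4 * pi * (fst u - x1) * snd v)"
        by (simp add: algebra_simps)
      then have 1: "e (4 * pi * ((x1 - fst u) * (x2 - snd v) - (x1 - fst v) * (x2 - snd u)))
        = (e (4 * pi * (- x2) * fst u) * e (4 * pi * x1 * snd u))
          * (e (4 * pi * (x2 - snd u) * fst v) * e (4 * pi * (fst u - x1) * snd v))"
        by (simp only: e_add)
      have 2: "gauss v = of_real (exp (- ((2 * pi) * (fst v)\<^sup>2))) * of_real (exp (- ((2 * pi) * (snd v)\<^sup>2)))"
        by (simp add: gauss_def distrib_left flip: exp_add of_real_mult)
      show ?thesis
        unfolding E_def 1 2 k_def e_def[of "4 * pi * (x2 - snd u) * fst v"] e_def[of "4 * pi * (fst u - x1) * snd v"]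
        by (simp only: mult_ac)
    qed
    have half: "sqrt (pi / (2 * pi)) * sqrt (pi / (2 * pi)) = 1 / 2"
      by simp
    have sq: "(4 * pi * s)\<^sup>2 / (4 * (2 * pi)) = 2 * pi * s\<^sup>2" for s
      by (simp add: power2_eq_square)
    have "(LINT v|lborel. E u v) = k * (LINT v|lborel. ?g (4 * pi * (x2 - snd u)) (fst v) * ?g (4 * pi * (fst u - x1)) (snd v))"
      unfolding E by (rule integral_mult_right_zero)
    also have "(LINT v|lborel. ?g (4 * pi * (x2 - snd u)) (fst v) * ?g (4 * pi * (fst u - x1)) (snd v))
       = (LINT v|lborel. ?g (4 * pi * (x2 - snd u)) v) * (LINT v|lborel. ?g (4 * pi * (fst u - x1)) v)"
      by (rule integral_lborel_product[OF fourier_gaussian(1)[OF pos] fourier_gaussian(1)[OF pos]])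
    also have "\<dots> = of_real (sqrt (pi / (2 * pi)) * exp (- (2 * pi * (x2 - snd u)\<^sup>2)))
       * of_real (sqrt (pi / (2 * pi)) * exp (- (2 * pi * (fst u - x1)\<^sup>2)))"
      unfolding fourier_gaussian(2)[OF pos] sq ..
    also have "\<dots> = of_real ((sqrt (pi / (2 * pi)) * sqrt (pi / (2 * pi))) *
          (exp (- (2 * pi * (x2 - snd u)\<^sup>2)) * exp (- (2 * pi * (fst u - x1)\<^sup>2))))"
      by (simp only: of_real_mult mult_ac)
    also have "\<dots> = 1 / 2 * of_real (exp (- (2 * pi * (x2 - snd u)\<^sup>2)) * exp (- (2 * pi * (fst u - x1)\<^sup>2)))"
      unfolding half by simp
    finally have 3: "(LINT v|lborel. E u v)
       = k * (1 / 2 * of_real (exp (- (2 * pi * (x2 - snd u)\<^sup>2)) * exp (- (2 * pi * (fst u - x1)\<^sup>2))))" .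
    have "exp (- (2 * pi * ((fst u)\<^sup>2 + (snd u)\<^sup>2))) *
          (exp (- (2 * pi * (x2 - snd u)\<^sup>2)) * exp (- (2 * pi * (fst u - x1)\<^sup>2)))
        = exp (- (2 * pi * (fst u)\<^sup>2) - 2 * pi * (fst u - x1)\<^sup>2) * exp (- (2 * pi * (snd u)\<^sup>2) - 2 * pi * (snd u - x2)\<^sup>2)"
      unfolding exp_add[symmetric] by (rule arg_cong[of _ _ exp]) (simp add: power2_eq_square algebra_simps)
    then have 4: "gauss u * of_real (exp (- (2 * pi * (x2 - snd u)\<^sup>2)) * exp (- (2 * pi * (fst u - x1)\<^sup>2)))
        = of_real (exp (- (2 * pi * (fst u)\<^sup>2) - 2 * pi * (fst u - x1)\<^sup>2)) * of_real (exp (- (2 * pi * (snd u)\<^sup>2) - 2 * pi * (snd u - x2)\<^sup>2))"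
      unfolding gauss_def by (simp only: flip: of_real_mult)
    have "(LINT v|lborel. E u v) = 1 / 2 * (gauss u * of_real (exp (- (2 * pi * (x2 - snd u)\<^sup>2)) * exp (- (2 * pi * (fst u - x1)\<^sup>2))))
       * (e (4 * pi * (- x2) * fst u) * e (4 * pi * x1 * snd u))"
      unfolding 3 k_def by (simp only: mult_ac)
    then show ?thesis
      unfolding 4 e_def by (simp only: mult_ac)
  qed
  have "(LINT p|lborel. (case p of (u, v) \<Rightarrow> E u v)) = (LINT u|lborel. LINT v|lborel. E u v)"
    using lborel_pair.integral_fst[OF int] by (simp only: lborel_prod)
  also have "\<dots> = 1 / 2 * (LINT u|lborel. ?f x1 (- x2) (fst u) * ?f x2 x1 (snd u))"
    unfolding inner by (rule integral_mult_right_zero)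
  also have "(LINT u|lborel. ?f x1 (- x2) (fst u) * ?f x2 x1 (snd u))
     = (LINT u|lborel. ?f x1 (- x2) u) * (LINT u|lborel. ?f x2 x1 u)"
    by (rule integral_lborel_product[OF fourier_two_gaussians(1) fourier_two_gaussians(1)])
  also have "\<dots> = (of_real (exp (- (pi * (x1\<^sup>2 + (- x2)\<^sup>2))) / 2) * exp (\<i> * of_real (2 * pi * x1 * (- x2))))
     * (of_real (exp (- (pi * (x2\<^sup>2 + x1\<^sup>2))) / 2) * exp (\<i> * of_real (2 * pi * x2 * x1)))"
    unfolding fourier_two_gaussians(2) ..
  also have "\<dots> = of_real (exp (- (pi * (x1\<^sup>2 + x2\<^sup>2))) * exp (- (pi * (x1\<^sup>2 + x2\<^sup>2))) / 4)
     * (exp (\<i> * of_real (2 * pi * x1 * (- x2))) * exp (\<i> * of_real (2 * pi * x2 * x1)))"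
    by (simp add: add.commute)
  \<comment> \<open>The recentring phases of the two coordinates are opposite, by antisymmetry of
    the phase in the product.\<close>
  also have "exp (\<i> * complex_of_real (2 * pi * x1 * (- x2))) * exp (\<i> * of_real (2 * pi * x2 * x1)) = 1"
    unfolding exp_add[symmetric] by (simp add: mult_ac)
  also have "exp (- (pi * (x1\<^sup>2 + x2\<^sup>2))) * exp (- (pi * (x1\<^sup>2 + x2\<^sup>2))) = exp (- (2 * pi * (x1\<^sup>2 + x2\<^sup>2)))"
    by (simp flip: exp_add)
  \<comment> \<open>A factor 1/2 comes from the inner and 1/4 from the outer integral; the prefactor
    4 in \<open>alg_mult\<close> turns 1/8 into 1/2.\<close>
  also have "1 / 2 * (complex_of_real (exp (- (2 * pi * (x1\<^sup>2 + x2\<^sup>2))) / 4) * 1) = 1 / 8 * gauss x"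
    by (simp add: gauss_def x1_def x2_def)
  finally have "(LINT p|lborel. (case p of (u, v) \<Rightarrow> E u v)) = 1 / 8 * gauss x" .
  moreover have "alg_mult gauss gauss x = 4 * (LINT p|lborel. (case p of (u, v) \<Rightarrow> E u v))"
    by (simp add: alg_mult_def split_def E_def e_def x1_def x2_def mult_ac)
  ultimately show "alg_mult gauss gauss x = 1 / 2 * gauss x" by (simp only: mult.assoc[symmetric]) simp
qed

lemma alg_star_gauss: "alg_star gauss = gauss"
  by (simp add: fun_eq_iff alg_star_def gauss_def)

lemma laplace_gauss_pos: "\<exists>r>0. laplace p q gauss = of_real r"
proof -
  define g where "g u = exp (- (2 * pi * ((fst u)\<^sup>2 + (snd u)\<^sup>2))) * exp (p * fst u + q * snd u)" for u :: "real \<times> real"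
  have g: "gauss u * of_real (exp (p * fst u + q * snd u)) = complex_of_real (g u)" for u
    by (simp add: gauss_def g_def)
  have "integrable lborel (\<lambda>u. complex_of_real (g u))"
    unfolding g[symmetric] gauss_strip by (rule tame_integrable_exp_linear[OF tame_gauss_ext])
  then have ig: "integrable lborel g"
    by (simp add: complex_of_real_integrable_eq)
  have pos: "0 < g u" for u by (simp add: g_def)
  have "0 \<le> (LINT u|lborel. g u)"
    by (intro Bochner_Integration.integral_nonneg less_imp_le pos)
  moreover have "(LINT u|lborel. g u) \<noteq> 0"
  proof
    assume "(LINT u|lborel. g u) = 0"
    then have "AE u in lborel. g u = 0"
      using integral_nonneg_eq_0_iff_AE[OF ig] pos by (simp add: less_imp_le)
    then have "AE u in (lborel :: (real \<times> real) measure). False"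
      by eventually_elim (use pos in \<open>simp add: less_le\<close>)
    then show False
      by (simp add: eventually_False ae_filter_eq_bot_iff)
  qed
  ultimately have "(LINT u|lborel. g u) > 0" by simp
  moreover have "laplace p q gauss = of_real (LINT u|lborel. g u)"
    unfolding laplace_def g by simp
  ultimately show ?thesis by blast
qed

section \<open>Identification of the functional\<close>

theorem theorem25:
  fixes q :: complex and \<gamma> \<alpha> \<beta> :: real
    and k :: "int \<times> int" and c d :: "real \<times> real"
    and h :: "plane_fun \<Rightarrow> complex"
  assumes "cmod q = 1" and "q \<noteq> 1" and "q \<noteq> - 1"
    and "q = exp (2 * pi * \<i> * \<gamma>)"
    and "\<alpha> * \<beta> = \<gamma>"
    and "8 * \<bar>fst c * fst d\<bar> < 1" and "8 * \<bar>snd c * snd d\<bar> < 1"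
    and "linear_functional h" and "positive_functional h" and "faithful_functional h"
    and "\<forall>(s::real) (t::real). \<forall>a\<in>algA. h (\<lambda>(x1, x2). a (x1 + \<beta> * s, x2 + \<alpha> * t))
           = of_real (exp (- 2 * pi * \<gamma> * (s + t) - 4 * pi * (of_int (fst k) * s + of_int (snd k) * t))) * h a"
    and "\<exists>C::real>0. \<forall>a\<in>algA. cmod (h a) \<le> C * norm_L2 (S_expQ c (S_expP d a))"
  shows "\<exists>\<nu>::real. \<nu> > 0 \<and> (\<forall>a\<in>algA. h a = of_real \<nu> * hk \<alpha> \<beta> k a)"
proof -
  \<comment> \<open>\<gamma> = 0 would force \<open>q = 1\<close>. The nonvanishing of \<alpha> and
    \<beta> lets every real translation be written in the form of the covariance hypothesis.\<close>
  have "\<gamma> \<noteq> 0"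
    using assms(2,4) by auto
  then have nz: "\<alpha> \<noteq> 0" "\<beta> \<noteq> 0"
    using assms(5) by auto
  define A B where "A = 2 * pi * \<alpha>k \<alpha> \<beta> k" and "B = 2 * pi * \<beta>k \<alpha> \<beta> k"
  have cov: "h (translate u a) = of_real (exp (A * fst u + B * snd u)) * h a" if "a \<in> algA" for u a
  proof -
    define s t where "s = - (fst u / \<beta>)" and "t = - (snd u / \<alpha>)"
    have "translate u a = (\<lambda>(x1, x2). a (x1 + \<beta> * s, x2 + \<alpha> * t))"
      using nz by (auto simp: fun_eq_iff translate_def s_def t_def minus_prod_def)
    \<comment> \<open>In the first coordinate \<open>s = - fst u / \<beta>\<close> and \<gamma> =
      \<alpha> \<beta> turn the exponent into
      \<open>2 * pi * (\<alpha> + 2 * fst k / \<beta>) * fst u\<close>, that is, the frequency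
      \<open>\<alpha>k\<close>; likewise in the second.\<close>
    moreover have "- 2 * pi * \<gamma> * (s + t) - 4 * pi * (of_int (fst k) * s + of_int (snd k) * t)
       = A * fst u + B * snd u"
      using nz by (simp add: A_def B_def \<alpha>k_def \<beta>k_def s_def t_def assms(5)[symmetric] field_simps)
    ultimately show ?thesis
      using assms(11) that by metis
  qed
  obtain C where "\<forall>a\<in>algA. cmod (h a) \<le> C * norm_L2 (S_expQ c (S_expP d a))"
    using assms(12) by blast
  then have proportional: "laplace A B gauss * h a = laplace A B a * h gauss" if "a \<in> algA" for a
    using covariant_functional_proportional[OF assms(8) cov _ that gauss_algA] by blast
  have hk: "hk \<alpha> \<beta> k a = laplace A B a" for a
    by (simp add: hk_def laplace_def A_def B_def split_def algebra_simps)
  obtain r where r: "r > 0" "laplace A B gauss = of_real r"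
    using laplace_gauss_pos by blast
  \<comment> \<open>Because the Gaussian is self-adjoint and proportional to its own square, the
    hypotheses on squares become statements about \<open>h gauss\<close> itself: positivity makes it
    nonnegative, faithfulness makes it nonzero.\<close>
  have half: "h (alg_mult (alg_star gauss) gauss) = 1 / 2 * h gauss"
    using assms(8) gauss_algA unfolding alg_star_gauss alg_mult_gauss linear_functional_def by blast
  have "h gauss \<in> \<real>\<^sub>\<ge>\<^sub>0"
  proof -
    have "1 / 2 * h gauss \<in> \<real>\<^sub>\<ge>\<^sub>0"
      using assms(9) gauss_algA half unfolding positive_functional_def by metis
    then show ?thesis by (simp add: complex_nonneg_Reals_iff)
  qed
  then obtain \<eta> where \<eta>: "\<eta> \<ge> 0" "h gauss = of_real \<eta>"
    by (auto simp: nonneg_Reals_def)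
  have "\<eta> \<noteq> 0"
  proof
    assume "\<eta> = 0"
    then have "gauss = (\<lambda>x. 0)"
      using assms(10) gauss_algA half \<eta> unfolding faithful_functional_def by simp
    then show False
      by (simp add: fun_eq_iff gauss_def)
  qed
  show ?thesis
  \<comment> \<open>The constant is \<open>h gauss\<close> divided by the value of \<open>hk\<close>
    at the Gaussian, as read off from proportionality.\<close>
  proof (intro exI[of _ "\<eta> / r"] conjI ballI)
    show "\<eta> / r > 0" using \<eta> \<open>\<eta> \<noteq> 0\<close> r by simp
    fix a assume "a \<in> algA"
    from proportional[OF this] show "h a = of_real (\<eta> / r) * hk \<alpha> \<beta> k a"
      using r \<eta> by (simp add: hk field_simps)
  qed
qed

end
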